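(* Let $p\ge0$, $q\ge0$ with $pq<1$, let $F,G:\mathbb{S}^n\times B_1\to\mathbb{R}$ be uniformly elliptic operators with constants $0<\lambda\le\Lambda$ and uniformly continuous coefficients, and let $(u,v)$ be a non-negative bounded viscosity solution of $$F(D^2u,x)=v_+^{\,p}\ \text{in } B_1,\qquad G(D^2v,x)=u_+^{\,q}\ \text{in } B_1.$$ Set $|(u,v)|:=u^{\frac{1}{1+p}}+v^{\frac{1}{1+q}}$. If $y\in\overline{\{|(u,v)|>0\}}\cap B_{1/2}$, then for a constant $c>0$ depending on the dimension one has $$\sup_{\overline{B}_r(y)}|(u,v)|\ge c\,r^{\frac{2}{1-pq}}\quad\text{for any } r\in\left(0,\tfrac12\right).$$
   Context: $B_r(y)$ is the open ball of radius $r$ centered at $y$ ($B_r=B_r(0)$); $\mathbb{S}^n$ is the space of real symmetric $n\times n$ matrices. Uniform ellipticity: $\lambda\|N\|\le \mathcal{F}(M+N,x)-\mathcal{F}(M,x)\le\Lambda\|N\|$ for all $M\in\mathbb{S}^n$ and nonnegative definite $N$ ($\|N\|$ = largest eigenvalue). $s_+=\max\{s,0\}$. A viscosity solution is a pair of continuous functions $(u,v)$ such that whenever $\phi,\chi\in C^2$ and $u-\phi$, $v-\chi$ attain a local maximum at $x_0$, then $F(D^2\phi(x_0),x_0)\ge v_+^p(x_0)$ and $G(D^2\chi(x_0),x_0)\ge u_+^q(x_0)$, and whenever they attain a local minimum at $x_0$, the reverse inequalities $\le$ hold.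
   Formalization: The normalization F(0,x)=G(0,x)=0 in B_1 is added (without it F=G=tr M+1, p=q=0, u=v=ε constant is a counterexample), and c may depend on p, q, λ, Λ as well as on the dimension. *)

theory Defs
  imports "HOL-Analysis.Analysis"
begin

definition sym_mat :: "real^'n^'n \<Rightarrow> bool" where
  "sym_mat M \<longleftrightarrow> transpose M = M"

definition nonneg_def :: "real^'n^'n \<Rightarrow> bool" where
  "nonneg_def N \<longleftrightarrow> sym_mat N \<and> (\<forall>x. 0 \<le> x \<bullet> (N *v x))"

definition largest_eig :: "real^'n^'n \<Rightarrow> real" where
  "largest_eig N = Max {e. \<exists>x. x \<noteq> 0 \<and> N *v x = e *\<^sub>R x}"

definition unif_elliptic :: "(real^'n^'n \<Rightarrow> real^'n \<Rightarrow> real) \<Rightarrow> real \<Rightarrow> real \<Rightarrow> bool" where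
  "unif_elliptic F lam Lam \<longleftrightarrow>
     (\<forall>M N x. sym_mat M \<longrightarrow> nonneg_def N \<longrightarrow> x \<in> ball 0 1 \<longrightarrow>
        lam * largest_eig N \<le> F (M + N) x - F M x \<and>
        F (M + N) x - F M x \<le> Lam * largest_eig N)"

definition unif_cont_coeff :: "(real^'n^'n \<Rightarrow> real^'n \<Rightarrow> real) \<Rightarrow> bool" where
  "unif_cont_coeff F \<longleftrightarrow> (\<forall>M. sym_mat M \<longrightarrow> uniformly_continuous_on (ball 0 1) (F M))"

definition C2_with :: "(real^'n \<Rightarrow> real) \<Rightarrow> (real^'n \<Rightarrow> real^'n) \<Rightarrow> (real^'n \<Rightarrow> real^'n^'n) \<Rightarrow> bool" where
  "C2_with \<phi> g H \<longleftrightarrow>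
     (\<forall>x. (\<phi> has_derivative (\<lambda>h. g x \<bullet> h)) (at x)) \<and>
     (\<forall>x. (g has_derivative (\<lambda>h. H x *v h)) (at x)) \<and>
     continuous_on UNIV H"

definition loc_max_in :: "(real^'n) set \<Rightarrow> (real^'n \<Rightarrow> real) \<Rightarrow> real^'n \<Rightarrow> bool" where
  "loc_max_in S f x0 \<longleftrightarrow> (\<exists>e>0. \<forall>x\<in>S \<inter> ball x0 e. f x \<le> f x0)"

definition loc_min_in :: "(real^'n) set \<Rightarrow> (real^'n \<Rightarrow> real) \<Rightarrow> real^'n \<Rightarrow> bool" where
  "loc_min_in S f x0 \<longleftrightarrow> (\<exists>e>0. \<forall>x\<in>S \<inter> ball x0 e. f x0 \<le> f x)"

text \<open>s_+^p, with Isabelle's convention 0 powr p = 0 (so s_+^0 = indicator of s > 0).\<close>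
definition pospow :: "real \<Rightarrow> real \<Rightarrow> real" where
  "pospow s p = (max s 0) powr p"

definition visc_sol ::
  "(real^'n^'n \<Rightarrow> real^'n \<Rightarrow> real) \<Rightarrow> (real^'n^'n \<Rightarrow> real^'n \<Rightarrow> real) \<Rightarrow> real \<Rightarrow> real \<Rightarrow>
   (real^'n \<Rightarrow> real) \<Rightarrow> (real^'n \<Rightarrow> real) \<Rightarrow> bool" where
  "visc_sol F G p q u v \<longleftrightarrow>
     continuous_on (ball 0 1) u \<and> continuous_on (ball 0 1) v \<and>
     (\<forall>\<phi> g H x0. C2_with \<phi> g H \<longrightarrow> x0 \<in> ball 0 1 \<longrightarrow>
        (loc_max_in (ball 0 1) (\<lambda>x. u x - \<phi> x) x0 \<longrightarrow> F (H x0) x0 \<ge> pospow (v x0) p) \<and>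
        (loc_min_in (ball 0 1) (\<lambda>x. u x - \<phi> x) x0 \<longrightarrow> F (H x0) x0 \<le> pospow (v x0) p) \<and>
        (loc_max_in (ball 0 1) (\<lambda>x. v x - \<phi> x) x0 \<longrightarrow> G (H x0) x0 \<ge> pospow (u x0) q) \<and>
        (loc_min_in (ball 0 1) (\<lambda>x. v x - \<phi> x) x0 \<longrightarrow> G (H x0) x0 \<le> pospow (u x0) q))"

definition pair_abs :: "real \<Rightarrow> real \<Rightarrow> (real^'n \<Rightarrow> real) \<Rightarrow> (real^'n \<Rightarrow> real) \<Rightarrow> real^'n \<Rightarrow> real" where
  "pair_abs p q u v x = u x powr (1 / (1 + p)) + v x powr (1 / (1 + q))"

end

theory Submission
  imports Defs
begin

text \<open>
  Only the subsolution property is used. If a paraboloid of opening \<open>a\<close> touches \<open>v\<close> from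
  above, then \<open>u\<^sup>q\<close> is at most a multiple of \<open>a\<close> there. Sliding paraboloids of opening
  proportional to \<open>\<delta> / r\<^sup>2\<close> down to \<open>0 \<le> v \<le> \<delta>\<close> in a ball of radius \<open>r\<close> produces contact points
  filling a universal fraction of the ball: by comparison with a Gaussian barrier the map from contact
  points to vertices is Lipschitz with a universal constant, so no second-order differentiability of
  convex functions is needed. On the other hand, near a point where \<open>u\<close> almost attains its
  maximum \<open>M\<close>, a Krylov--Safonov argument (the same contact estimate, iterated by growing ink spots)
  shows that \<open>u \<ge> M / 2\<close> outside an arbitrarily small fraction of the ball. The two sets meet, whence
  \<open>M\<^sup>q\<close> is bounded by a multiple of \<open>\<delta> / r\<^sup>2\<close>. Since \<open>pq < 1\<close>, this lower bound, together with
  its counterpart with the roles of \<open>u\<close> and \<open>v\<close> exchanged, propagates the growth at scale \<open>r / 2\<close>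
  to growth at scale \<open>r\<close>; at very small scales growth is trivial because \<open>u\<close> or \<open>v\<close> is positive
  at the centre.
\<close>

section \<open>Covering estimates\<close>

lemma measure_lebesgue_ball:
  fixes c :: "'a::euclidean_space"
  assumes "r \<ge> 0"
  shows "measure lebesgue (ball c r) = r ^ DIM('a) * unit_ball_vol (DIM('a))"
  using content_ball[OF assms, of c] by (simp add: mult.commute)

lemma measure_lebesgue_ball_scale:
  fixes c c' :: "'a::euclidean_space"
  assumes "k \<ge> 0" "r \<ge> 0"
  shows "measure lebesgue (ball c (k * r)) = k ^ DIM('a) * measure lebesgue (ball c' r)"
  using assms measure_lebesgue_ball[of "k * r" c] measure_lebesgue_ball[of r c']
  by (simp add: power_mult_distrib)

text \<open>Disjointness bounds every finite subfamily of the cover by \<open>k\<close> times the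
  measure of \<open>U\<close>, and a uniform bound on finite unions passes to the countable
  union.\<close>

lemma measure_le_disjoint_cover:
  fixes A D :: "'i \<Rightarrow> 'a::euclidean_space set"
  assumes "countable C" "V \<subseteq> (\<Union>i\<in>C. A i)" "V \<in> lmeasurable" "U \<in> lmeasurable" "0 \<le> k"
    and A: "\<And>i. i \<in> C \<Longrightarrow> A i \<in> lmeasurable"
    and D: "\<And>i. i \<in> C \<Longrightarrow> D i \<in> lmeasurable" "\<And>i. i \<in> C \<Longrightarrow> D i \<subseteq> U"
    and disj: "pairwise (\<lambda>i j. disjnt (D i) (D j)) C"
    and AD: "\<And>i. i \<in> C \<Longrightarrow> measure lebesgue (A i) \<le> k * measure lebesgue (D i)"
  shows "measure lebesgue V \<le> k * measure lebesgue U"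
proof -
  have bd: "measure lebesgue (\<Union>i\<in>I. A i) \<le> k * measure lebesgue U" if I: "I \<subseteq> C" "finite I" for I
  proof -
    have "measure lebesgue (\<Union>i\<in>I. A i) \<le> (\<Sum>i\<in>I. measure lebesgue (A i))"
      using I A by (intro measure_UNION_le) (auto intro: fmeasurableD)
    also have "\<dots> \<le> (\<Sum>i\<in>I. k * measure lebesgue (D i))"
      using I AD by (intro sum_mono) auto
    also have "\<dots> = k * measure lebesgue (\<Union>i\<in>I. D i)"
      using I D disj by (subst measure_UNION') (auto simp: sum_distrib_left intro: pairwise_subset)
    also have "\<dots> \<le> k * measure lebesgue U"
      using I D assms(4,5) by (intro mult_left_mono measure_mono_fmeasurable)
        (auto intro!: sets.finite_UN fmeasurableD)
    finally show ?thesis .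
  qed
  have "measure lebesgue V \<le> measure lebesgue (\<Union>i\<in>C. A i)"
    using assms(2,3) fmeasurable_UN_bound[OF assms(1) A bd]
    by (intro measure_mono_fmeasurable) (auto intro: fmeasurableD)
  also have "\<dots> \<le> k * measure lebesgue U"
    by (rule measure_UN_bound[OF assms(1) A bd])
  finally show ?thesis .
qed

text \<open>The inverse of \<open>h\<close> is \<open>C\<close>-Lipschitz, so the points of
  \<open>V\<close> that \<open>h\<close> sends into a ball lie in a ball \<open>C\<close> times
  larger. \<open>W\<close> stands in for the image of \<open>V\<close>, whose measurability is not
  known; the factor 5 is the enlargement in Vitali's lemma.\<close>

lemma measure_le_expansive_image:
  fixes h :: "'a::euclidean_space \<Rightarrow> 'a"
  assumes V: "V \<in> lmeasurable" and W: "W \<in> lmeasurable" and "0 < C"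
    and hW: "\<And>y. y \<in> V \<Longrightarrow> h y \<in> W"
    and h: "\<And>y y'. y \<in> V \<Longrightarrow> y' \<in> V \<Longrightarrow> norm (y - y') \<le> C * norm (h y - h y')"
  shows "measure lebesgue V \<le> (5 * C) ^ DIM('a) * measure lebesgue W"
proof -
  have "measure lebesgue V \<le> (5 * C) ^ DIM('a) * measure lebesgue W + e" if "e > 0" for e
  proof -
    define k where "k = (5 * C) ^ DIM('a)"
    have k: "k > 0" using \<open>0 < C\<close> by (simp add: k_def)
    \<comment> \<open>The balls around image points need an open set to lie in. Its excess over
      \<open>W\<close> is below \<open>e / k\<close>, so that multiplication by \<open>k\<close>
      costs only \<open>e\<close>.\<close>
    obtain T where T: "open T" "W \<subseteq> T" "T - W \<in> lmeasurable"
        "emeasure lebesgue (T - W) < ennreal (e / k)"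
      using sets_lebesgue_outer_open[of W "e / k"] W k \<open>e > 0\<close> by (auto intro: fmeasurableD)
    have Tm: "T \<in> lmeasurable"
      using fmeasurable.Un[OF W T(3)] T(2) by (simp add: Un_Diff_cancel2 sup.absorb2)
    have "measure lebesgue T = measure lebesgue W + measure lebesgue (T - W)"
      using T Tm W by (simp add: measurable_measure_Diff fmeasurableD)
    moreover have "measure lebesgue (T - W) \<le> e / k"
      using T(3,4) k \<open>e > 0\<close> by (simp add: emeasure_eq_measure2 ennreal_less_iff)
    ultimately have Tle: "measure lebesgue T \<le> measure lebesgue W + e / k" by simp
    \<comment> \<open>Vitali's lemma needs bounded radii, hence the cap 1.\<close>
    have "\<exists>r>0. r \<le> 1 \<and> ball (h y) r \<subseteq> T" if y: "y \<in> V" for y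
    proof -
      obtain r where "r > 0" "ball (h y) r \<subseteq> T"
        using openE[OF T(1), of "h y"] T(2) hW[OF y] by blast
      then show ?thesis
        by (intro exI[of _ "min r 1"]) (auto simp: subset_iff)
    qed
    then obtain r where r: "\<And>y. y \<in> V \<Longrightarrow> 0 < r y \<and> r y \<le> 1"
        and rT: "\<And>y. y \<in> V \<Longrightarrow> ball (h y) (r y) \<subseteq> T"
      by metis
    have hV: "h ` V \<subseteq> (\<Union>y\<in>V. ball (h y) (r y))"
      using r by force
    obtain K where K: "countable K" "K \<subseteq> V"
        "pairwise (\<lambda>i j. disjnt (ball (h i) (r i)) (ball (h j) (r j))) K"
        "h ` V \<subseteq> (\<Union>i\<in>K. ball (h i) (5 * r i))"
      by (rule Vitali_covering_lemma_balls[OF hV r])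
    have cov: "V \<subseteq> (\<Union>i\<in>K. ball i (5 * C * r i))"
    proof
      fix y assume y: "y \<in> V"
      then obtain i where i: "i \<in> K" "dist (h i) (h y) < 5 * r i"
        using K(4) by auto
      then have "norm (i - y) \<le> C * norm (h i - h y)"
        using K(2) y h by auto
      also have "\<dots> < C * (5 * r i)"
        using i \<open>0 < C\<close> by (intro mult_strict_left_mono) (auto simp: dist_norm)
      finally show "y \<in> (\<Union>i\<in>K. ball i (5 * C * r i))"
        using i by (auto simp: dist_norm algebra_simps)
    qed
    have "measure lebesgue V \<le> k * measure lebesgue T"
    proof (rule measure_le_disjoint_cover[OF K(1) cov V Tm _ _ _ _ K(3)])
      fix i assume "i \<in> K"
      with K r have "r i > 0" by auto
      then show "measure lebesgue (ball i (5 * C * r i)) \<le> k * measure lebesgue (ball (h i) (r i))"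
        using \<open>0 < C\<close> measure_lebesgue_ball_scale[of "5 * C" "r i" i "h i"] by (simp add: k_def)
    qed (use k K rT in auto)
    also have "\<dots> \<le> k * (measure lebesgue W + e / k)"
      using Tle k by (intro mult_left_mono) auto
    also have "\<dots> = k * measure lebesgue W + e"
      using k by (simp add: field_simps)
    finally show ?thesis by (simp add: k_def)
  qed
  then show ?thesis by (rule field_le_epsilon)
qed

text \<open>Growing ink spots: every point of \<open>E\<close> lies in a ball inside
  \<open>ball c R\<close> in which \<open>E\<close> has density exactly \<open>1 - mu\<close>. Such
  a ball lies in \<open>F\<close>, and the fraction \<open>mu\<close> of it lies outside
  \<open>E\<close>. A disjoint Vitali subfamily then bounds the measure of \<open>E\<close> by
  \<open>5 ^ n / mu\<close> times that of \<open>F - E\<close>.\<close>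

lemma ink_spots:
  fixes c :: "'a::euclidean_space"
  assumes E: "open E" "E \<subseteq> ball c R" and F: "F \<in> lmeasurable" and mu: "0 < mu" "mu < 1"
    and small: "measure lebesgue E < (1 - mu) * measure lebesgue (ball c R)"
    and fill: "\<And>z s. 0 < s \<Longrightarrow> ball z s \<subseteq> ball c R \<Longrightarrow>
      (1 - mu) * measure lebesgue (ball z s) \<le> measure lebesgue (ball z s \<inter> E) \<Longrightarrow> ball z s \<subseteq> F"
  shows "(1 + mu / 5 ^ DIM('a)) * measure lebesgue E \<le> measure lebesgue F"
proof -
  have Em: "E \<in> lmeasurable"
    using E by (meson bounded_ball bounded_subset lmeasurable_open)
  \<comment> \<open>\<open>B x t\<close> is the image of \<open>ball c R\<close> under the homothety
    with centre \<open>x\<close> and ratio \<open>t\<close>; for \<open>x\<close> in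
    \<open>E\<close> these balls increase with \<open>t\<close> and fill \<open>ball c R\<close> at
    \<open>t = 1\<close>.\<close>
  define B where "B x t = ball (x + t *\<^sub>R (c - x)) (t * R)" for x t
  have ex: "\<exists>t>0. t \<le> 1 \<and> measure lebesgue (B x t \<inter> E) = (1 - mu) * measure lebesgue (B x t)"
    if x: "x \<in> E" for x
  proof -
    have xR: "norm (c - x) < R"
      using x E by (auto simp: dist_norm)
    then have R: "R > 0"
      using norm_ge_zero le_less_trans by blast
    have mono: "B x s \<subseteq> B x t" if "s \<le> t" for s t
    proof -
      have "dist (x + s *\<^sub>R (c - x)) (x + t *\<^sub>R (c - x)) = norm ((s - t) *\<^sub>R (c - x))"
        by (simp add: dist_norm algebra_simps)
      also have "\<dots> = (t - s) * norm (c - x)"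
        using that by simp
      also have "\<dots> \<le> (t - s) * R"
        using that xR by (intro mult_left_mono) auto
      finally show ?thesis
        unfolding B_def by (subst ball_subset_ball_iff) (auto simp: algebra_simps)
    qed
    define f where "f t = measure lebesgue (B x t \<inter> E)" for t
    define g where "g t = measure lebesgue (B x t)" for t
    have Bm: "B x t \<in> lmeasurable" for t by (simp add: B_def)
    \<comment> \<open>The increments of \<open>f\<close> are dominated by those of \<open>g\<close>,
      so \<open>f\<close> inherits the continuity of the explicit function \<open>g\<close>.\<close>
    have lip: "0 \<le> f t - f s \<and> f t - f s \<le> g t - g s" if "s \<le> t" for s t
    proof -
      have "f s \<le> f t"
        unfolding f_def using mono[OF that] Bm Em
        by (intro measure_mono_fmeasurable) (auto intro: fmeasurableD)
      moreover have "f t - f s = measure lebesgue (B x t \<inter> E - B x s \<inter> E)"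
        unfolding f_def using mono[OF that] Bm Em
        by (subst measurable_measure_Diff) (auto intro: fmeasurableD)
      moreover have "B x t \<inter> E - B x s \<inter> E = (B x t - B x s) \<inter> E" by auto
      moreover have "measure lebesgue ((B x t - B x s) \<inter> E) \<le> measure lebesgue (B x t - B x s)"
        using Bm Em by (intro measure_mono_fmeasurable) (auto intro: fmeasurableD)
      moreover have "measure lebesgue (B x t - B x s) = g t - g s"
        unfolding g_def using mono[OF that] Bm by (simp add: measurable_measure_Diff fmeasurableD)
      ultimately show ?thesis by (simp add: f_def)
    qed
    have g: "g t = (t * R) ^ DIM('a) * unit_ball_vol (DIM('a))" if "t \<ge> 0" for t
      using that R by (simp only: g_def B_def) (subst measure_lebesgue_ball, auto)
    have gc: "continuous_on {0..1} g"
      by (rule continuous_on_eq[of _ "\<lambda>t. (t * R) ^ DIM('a) * unit_ball_vol (DIM('a))"])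
         (auto intro!: continuous_intros simp: g)
    have fc: "continuous_on {0..1} f"
      unfolding continuous_on_iff
    proof (intro ballI allI impI)
      fix s e :: real assume s: "s \<in> {0..1}" "e > 0"
      then obtain d where d: "d > 0" "\<And>t. t \<in> {0..1} \<Longrightarrow> dist t s < d \<Longrightarrow> dist (g t) (g s) < e"
        using gc unfolding continuous_on_iff by blast
      show "\<exists>d>0. \<forall>t\<in>{0..1}. dist t s < d \<longrightarrow> dist (f t) (f s) < e"
      proof (intro exI[of _ d] conjI ballI impI d(1))
        fix t assume "t \<in> {0..1}" "dist t s < d"
        with d(2) have "\<bar>g t - g s\<bar> < e" by (auto simp: dist_real_def)
        moreover have "\<bar>f t - f s\<bar> \<le> \<bar>g t - g s\<bar>"
          using lip[of s t] lip[of t s] by (cases "s \<le> t") auto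
        ultimately show "dist (f t) (f s) < e" by (simp add: dist_real_def)
      qed
    qed
    obtain e where e: "e > 0" "ball x e \<subseteq> E"
      using E(1) x openE by blast
    \<comment> \<open>At this ratio \<open>B x t0\<close> still lies in \<open>ball x e\<close>, so
      \<open>E\<close> has density 1 in it.\<close>
    define t0 where "t0 = min 1 (e / (2 * R))"
    have t0: "0 < t0" "t0 \<le> 1" "t0 * (2 * R) \<le> e"
      using e R by (auto simp: t0_def min_def field_simps)
    have "B x t0 \<subseteq> ball x e"
    proof -
      have "dist (x + t0 *\<^sub>R (c - x)) x = t0 * norm (c - x)"
        using t0 by (simp add: dist_norm)
      also have "\<dots> \<le> t0 * R"
        using t0 xR by (intro mult_left_mono) auto
      finally show ?thesis
        unfolding B_def using t0 by (subst ball_subset_ball_iff) (auto simp: algebra_simps)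
    qed
    then have "B x t0 \<inter> E = B x t0" using e by auto
    then have "f t0 = g t0" by (simp add: f_def g_def)
    moreover have "g t0 > 0" using g[of t0] t0 R by simp
    ultimately have 1: "0 \<le> f t0 - (1 - mu) * g t0" using mu by (simp add: algebra_simps)
    have "B x 1 = ball c R" by (simp add: B_def)
    then have 2: "f 1 - (1 - mu) * g 1 \<le> 0"
      using small E(2) by (simp add: f_def g_def Int_absorb1)
    have "continuous_on {t0..1} (\<lambda>t. f t - (1 - mu) * g t)"
      by (intro continuous_intros continuous_on_subset[OF fc] continuous_on_subset[OF gc]) (use t0 in auto)
    \<comment> \<open>The density of \<open>E\<close> is 1 at \<open>t0\<close> and below
      \<open>1 - mu\<close> at ratio 1; the intermediate value theorem gives equality in
      between.\<close>
    then obtain t where "t0 \<le> t" "t \<le> 1" "f t - (1 - mu) * g t = 0"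
      using IVT2'[of "\<lambda>t. f t - (1 - mu) * g t" 1 0 t0] 1 2 t0 by blast
    then show ?thesis
      using t0 by (intro exI[of _ t]) (auto simp: f_def g_def)
  qed
  then obtain t where t: "\<And>x. x \<in> E \<Longrightarrow> 0 < t x \<and> t x \<le> 1"
    and teq: "\<And>x. x \<in> E \<Longrightarrow> measure lebesgue (B x (t x) \<inter> E) = (1 - mu) * measure lebesgue (B x (t x))"
    by metis
  define z where "z x = x + t x *\<^sub>R (c - x)" for x
  define s where "s x = t x * R" for x
  have Bz: "B x (t x) = ball (z x) (s x)" for x by (simp add: B_def z_def s_def)
  have Rpos: "R > 0" if "x \<in> E" for x
    using that E(2) by (metis ball_empty empty_iff not_le subset_empty)
  have s: "0 < s x \<and> s x \<le> R" if "x \<in> E" for x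
    using t[OF that] Rpos[OF that] by (auto simp: s_def mult_le_cancel_right1)
  have xz: "x \<in> ball (z x) (s x)" and zc: "ball (z x) (s x) \<subseteq> ball c R" if "x \<in> E" for x
  proof -
    have n: "norm (c - x) < R" using that E by (auto simp: dist_norm)
    have "dist (z x) x = t x * norm (c - x)"
      using t[OF that] by (simp add: z_def dist_norm)
    also have "\<dots> < s x"
      unfolding s_def using n t[OF that] by (intro mult_strict_left_mono) auto
    finally show "x \<in> ball (z x) (s x)" by simp
    have "dist (z x) c = norm ((1 - t x) *\<^sub>R (x - c))"
      by (simp add: z_def dist_norm algebra_simps)
    also have "\<dots> = (1 - t x) * norm (c - x)"
      using t[OF that] by (simp add: norm_minus_commute)
    also have "\<dots> \<le> (1 - t x) * R"
      using n t[OF that] by (intro mult_left_mono) auto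
    finally show "ball (z x) (s x) \<subseteq> ball c R"
      by (subst ball_subset_ball_iff) (auto simp: s_def algebra_simps)
  qed
  have zF: "ball (z x) (s x) \<subseteq> F" if "x \<in> E" for x
    using fill[OF _ zc[OF that]] s[OF that] teq[OF that] by (simp add: Bz)
  have EF: "E \<subseteq> F" using xz zF by blast
  have Ez: "E \<subseteq> (\<Union>x\<in>E. ball (z x) (s x))" using xz by blast
  obtain K where K: "countable K" "K \<subseteq> E"
      "pairwise (\<lambda>i j. disjnt (ball (z i) (s i)) (ball (z j) (s j))) K"
      "E \<subseteq> (\<Union>i\<in>K. ball (z i) (5 * s i))"
    by (rule Vitali_covering_lemma_balls[OF Ez s])
  have "measure lebesgue E \<le> (5 ^ DIM('a) / mu) * measure lebesgue (F - E)"
  proof (rule measure_le_disjoint_cover[OF K(1) K(4) Em, where D = "\<lambda>i. ball (z i) (s i) - E"])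
    show "pairwise (\<lambda>i j. disjnt (ball (z i) (s i) - E) (ball (z j) (s j) - E)) K"
      using K(3) by (auto simp: pairwise_def disjnt_def)
    fix i assume "i \<in> K"
    then have i: "i \<in> E" using K by auto
    show "ball (z i) (s i) - E \<subseteq> F - E" using zF[OF i] by auto
    have "measure lebesgue (ball (z i) (s i) - E) =
        measure lebesgue (ball (z i) (s i)) - measure lebesgue (ball (z i) (s i) \<inter> E)"
      using Em by (subst measurable_measure_Diff[symmetric]) 
        (auto intro!: arg_cong[where f="measure lebesgue"] fmeasurableD)
    also have "\<dots> = mu * measure lebesgue (ball (z i) (s i))"
      using teq[OF i] by (simp add: Bz algebra_simps)
    finally have "measure lebesgue (ball (z i) (s i) - E) = mu * measure lebesgue (ball (z i) (s i))" .
    then show "measure lebesgue (ball (z i) (5 * s i))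
        \<le> 5 ^ DIM('a) / mu * measure lebesgue (ball (z i) (s i) - E)"
      using s[OF i] mu measure_lebesgue_ball_scale[of 5 "s i" "z i" "z i"] by simp
    show "ball (z i) (s i) - E \<in> lmeasurable"
      using Em by (simp add: fmeasurable.Diff)
  qed (use mu F Em in \<open>auto intro: fmeasurable.Diff\<close>)
  moreover have "measure lebesgue (F - E) = measure lebesgue F - measure lebesgue E"
    using EF F Em by (simp add: measurable_measure_Diff fmeasurableD)
  ultimately show ?thesis
    using mu by (simp add: field_simps)
qed

section \<open>Subsolutions of extremal inequalities\<close>

text \<open>
  The only test functions ever needed are paraboloids minus Gaussians. The Hessian of such a function
  is a multiple of the identity minus a rank-one matrix, and the right-hand side below is the resulting
  bound on any uniformly elliptic operator vanishing at \<open>0\<close>.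
\<close>

definition subsol :: "real \<Rightarrow> real \<Rightarrow> (real^'n \<Rightarrow> real) \<Rightarrow> (real^'n) set \<Rightarrow> (real^'n \<Rightarrow> real) \<Rightarrow> bool" where
  "subsol lam Lam f S u \<longleftrightarrow>
     (\<forall>x0\<in>S. \<forall>y z. \<forall>a\<ge>0. \<forall>h\<ge>0. \<forall>b\<ge>0.
        loc_max_in S (\<lambda>x. u x - (a / 2 * (norm (x - y))\<^sup>2 - h * exp (- b * (norm (x - z))\<^sup>2))) x0 \<longrightarrow>
        f x0 \<le> Lam * (a + 2 * b * h * exp (- b * (norm (x0 - z))\<^sup>2))
          - lam * (4 * b\<^sup>2 * h * exp (- b * (norm (x0 - z))\<^sup>2) * (norm (x0 - z))\<^sup>2))"

lemma subsolD:
  assumes "subsol lam Lam f S u" "x0 \<in> S" "0 \<le> a" "0 \<le> h" "0 \<le> b"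
    "loc_max_in S (\<lambda>x. u x - (a / 2 * (norm (x - y))\<^sup>2 - h * exp (- b * (norm (x - z))\<^sup>2))) x0"
  shows "f x0 \<le> Lam * (a + 2 * b * h * exp (- b * (norm (x0 - z))\<^sup>2))
    - lam * (4 * b\<^sup>2 * h * exp (- b * (norm (x0 - z))\<^sup>2) * (norm (x0 - z))\<^sup>2)"
  using assms unfolding subsol_def by blast

context
  fixes lam Lam :: real
  assumes lam: "0 < lam" "lam \<le> Lam"
begin

definition bt :: real where "bt = Lam / lam"

definition gap :: real where "gap = exp (- 16 * bt) - exp (- 25 * bt)"

definition bend :: real where "bend = exp (25 * bt) / (2 * bt)"

lemma bt_pos: "bt > 0"
  using lam by (simp add: bt_def)

lemma gap_pos: "gap > 0" and bend_pos: "bend > 0"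
  using bt_pos by (auto simp: gap_def bend_def)

text \<open>
  With decay rate \<open>bt / r\<^sup>2\<close> the Gaussian has negative extremal operator on the annulus between the
  radii \<open>r\<close> and \<open>5 * r\<close>; \<open>gap\<close> is its least excess over the outer boundary value on the ball of radius
  \<open>4 * r\<close>, and \<open>bend\<close> measures how large the jump \<open>h\<close> must be to absorb the curvature of the paraboloid.
\<close>

lemma gaussian_barrier:
  fixes u f :: "real^'n \<Rightarrow> real"
  assumes sub: "subsol lam Lam f S u" and cont: "continuous_on S u"
    and f: "\<And>x. x \<in> S \<Longrightarrow> 0 \<le> f x" and S: "cball z (5 * r) \<subseteq> S" and "0 < r" "0 \<le> a"
    and h: "bend * a * r\<^sup>2 < h"
    and le: "\<And>x. x \<in> cball z (5 * r) \<Longrightarrow> u x \<le> C0 + a / 2 * (norm (x - y))\<^sup>2"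
    and gap: "\<And>x. x \<in> cball z r \<Longrightarrow> u x \<le> C0 + a / 2 * (norm (x - y))\<^sup>2 - h"
    and x: "x \<in> cball z (4 * r)"
  shows "u x \<le> C0 + a / 2 * (norm (x - y))\<^sup>2 - gap * h"
proof (rule ccontr)
  assume neg: "\<not> ?thesis"
  have "0 \<le> bend * a * r\<^sup>2" using bend_pos \<open>0 \<le> a\<close> by simp
  with h have h0: "h > 0" by linarith
  define b where "b = bt / r\<^sup>2"
  have b: "b > 0" using bt_pos \<open>0 < r\<close> by (simp add: b_def)
  have br: "b * (k * r)\<^sup>2 = bt * k\<^sup>2" for k
    using \<open>0 < r\<close> by (simp add: b_def power_mult_distrib)
  \<comment> \<open>\<open>D\<close> is \<open>u\<close> minus a test function. Its maximum over the
    large ball is located in the open annulus between radii \<open>r\<close> and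
    \<open>5 * r\<close>, where the subsolution inequality is violated.\<close>
  define D where "D x = u x - (a / 2 * (norm (x - y))\<^sup>2 - h * exp (- b * (norm (x - z))\<^sup>2))" for x
  have "continuous_on (cball z (5 * r)) D"
    unfolding D_def by (intro continuous_intros continuous_on_subset[OF cont S])
  then obtain w where w: "w \<in> cball z (5 * r)" and wmax: "\<And>x. x \<in> cball z (5 * r) \<Longrightarrow> D x \<le> D w"
    using continuous_attains_sup[of "cball z (5 * r)" D] \<open>0 < r\<close> by auto
  have "x \<in> cball z (5 * r)" using x \<open>0 < r\<close> by auto
  then have "D x \<le> D w" by (rule wmax)
  moreover have "D x > C0 - gap * h + h * exp (- b * (norm (x - z))\<^sup>2)"
    using neg by (simp add: D_def)
  moreover have "exp (- b * (norm (x - z))\<^sup>2) \<ge> exp (- 16 * bt)"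
  proof -
    have "(norm (x - z))\<^sup>2 \<le> (4 * r)\<^sup>2"
      using x by (intro power_mono) (auto simp: dist_norm norm_minus_commute)
    then have "b * (norm (x - z))\<^sup>2 \<le> b * (4 * r)\<^sup>2"
      using b by (intro mult_left_mono) auto
    also have "\<dots> = 16 * bt" using br[of 4] by simp
    finally have "b * (norm (x - z))\<^sup>2 \<le> 16 * bt" .
    then show ?thesis by simp
  qed
  then have "h * exp (- b * (norm (x - z))\<^sup>2) \<ge> h * exp (- 16 * bt)"
    using h0 by simp
  \<comment> \<open>Failure of the claim at \<open>x\<close> lifts the maximum above
    \<open>C0 + h * exp (- 25 * bt)\<close>, the largest value that \<open>D\<close> can take on the
    outer sphere.\<close>
  ultimately have Dw: "D w > C0 + h * exp (- 25 * bt)"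
    by (simp add: gap_def algebra_simps)
  have uw: "u w \<le> C0 + a / 2 * (norm (w - y))\<^sup>2" using le w by blast
  \<comment> \<open>On the inner ball the assumed drop by \<open>h\<close> offsets the Gaussian
    term, which is at most \<open>h\<close>.\<close>
  have far: "r < norm (w - z)"
  proof (rule ccontr)
    assume "\<not> r < norm (w - z)"
    then have "u w \<le> C0 + a / 2 * (norm (w - y))\<^sup>2 - h"
      by (intro gap) (auto simp: dist_norm norm_minus_commute)
    then have "D w \<le> C0 - h + h * exp (- b * (norm (w - z))\<^sup>2)" by (simp add: D_def)
    also have "\<dots> \<le> C0" using h0 b by simp
    also have "\<dots> \<le> C0 + h * exp (- 25 * bt)" using h0 by simp
    finally show False using Dw by simp
  qed
  have near: "norm (w - z) < 5 * r"
  proof (rule ccontr)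
    assume "\<not> norm (w - z) < 5 * r"
    with w have "norm (w - z) = 5 * r" by (auto simp: dist_norm norm_minus_commute)
    then have "b * (norm (w - z))\<^sup>2 = 25 * bt" using br[of 5] by simp
    then have "D w \<le> C0 + h * exp (- 25 * bt)" using uw by (simp add: D_def)
    with Dw show False by simp
  qed
  have wS: "w \<in> S" using w S by auto
  have "loc_max_in S D w"
    unfolding loc_max_in_def
  proof (intro exI[of _ "5 * r - norm (w - z)"] conjI ballI)
    fix x assume "x \<in> S \<inter> ball w (5 * r - norm (w - z))"
    then have "norm (w - x) < 5 * r - norm (w - z)" by (auto simp: dist_norm)
    then have "x \<in> cball z (5 * r)"
      using norm_triangle_ineq4[of "w - x" "w - z"] by (auto simp: dist_norm norm_minus_commute)
    then show "D x \<le> D w" by (rule wmax)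
  qed (use near in simp)
  then have "f w \<le> Lam * (a + 2 * b * h * exp (- b * (norm (w - z))\<^sup>2))
          - lam * (4 * b\<^sup>2 * h * exp (- b * (norm (w - z))\<^sup>2) * (norm (w - z))\<^sup>2)"
    using subsolD[OF sub wS \<open>0 \<le> a\<close>, of h b] h0 b unfolding D_def by simp
  moreover define e where "e = exp (- b * (norm (w - z))\<^sup>2)"
  ultimately have fw: "0 \<le> Lam * (a + 2 * b * h * e) - lam * (4 * b * h * e * (b * (norm (w - z))\<^sup>2))"
    using f[OF wS] by (simp add: power2_eq_square algebra_simps)
  \<comment> \<open>Beyond radius \<open>r\<close> the rank-one part of the Hessian dominates: as
    \<open>lam * bt = Lam\<close>, the two Gaussian terms combine to at most
    \<open>- 2 * Lam * b * h * e\<close>.\<close>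
  have "b * (norm (w - z))\<^sup>2 \<ge> bt"
    using br[of 1] b mult_left_mono[of "(1 * r)\<^sup>2" "(norm (w - z))\<^sup>2" b] far \<open>0 < r\<close> 
    by (simp add: power_mono)
  moreover have e0: "e > 0" by (simp add: e_def)
  ultimately have "lam * (4 * b * h * e * (b * (norm (w - z))\<^sup>2)) \<ge> lam * (4 * b * h * e * bt)"
    using lam b h0 by (intro mult_left_mono) auto
  also have "lam * (4 * b * h * e * bt) = Lam * (4 * b * h * e)" 
    using lam by (simp add: bt_def)
  finally have "0 \<le> Lam * (a - 2 * b * h * e)" using fw by (simp add: algebra_simps)
  then have a: "2 * b * h * e \<le> a" using lam by (simp add: zero_le_mult_iff)
  have "b * (norm (w - z))\<^sup>2 \<le> b * (5 * r)\<^sup>2"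
    using b near by (intro mult_left_mono power_mono) auto
  also have "\<dots> = 25 * bt" using br[of 5] by simp
  finally have "b * (norm (w - z))\<^sup>2 \<le> 25 * bt" .
  then have "e \<ge> exp (- 25 * bt)" by (simp add: e_def)
  then have "2 * b * h * exp (- 25 * bt) \<le> 2 * b * h * e" using b h0 by simp
  with a have "2 * b * h * exp (- 25 * bt) \<le> a" by linarith
  then have "h \<le> bend * a * r\<^sup>2"
    using bt_pos \<open>0 < r\<close> by (simp add: b_def bend_def exp_minus field_simps)
  with h show False by simp
qed

text \<open>Two paraboloids of equal opening differ by an affine function of slope
  \<open>a * norm (y0 - y1)\<close>. If the contact points were too close for their vertices, the
  second paraboloid would push \<open>u\<close> below the first on a small ball near
  \<open>x1\<close>, and the Gaussian barrier would carry this gap to \<open>x0\<close>, where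
  \<open>u\<close> touches the first.\<close>

lemma contact_expansive:
  fixes u f :: "real^'n \<Rightarrow> real"
  assumes sub: "subsol lam Lam f S u" and cont: "continuous_on S u"
    and f: "\<And>x. x \<in> S \<Longrightarrow> 0 \<le> f x" and S: "cball c \<rho> \<subseteq> S" and "0 < a"
    and le0: "\<And>x. x \<in> cball c \<rho> \<Longrightarrow> u x \<le> c0 + a / 2 * (norm (x - y0))\<^sup>2"
    and le1: "\<And>x. x \<in> cball c \<rho> \<Longrightarrow> u x \<le> c1 + a / 2 * (norm (x - y1))\<^sup>2"
    and eq0: "u x0 = c0 + a / 2 * (norm (x0 - y0))\<^sup>2"
    and eq1: "u x1 = c1 + a / 2 * (norm (x1 - y1))\<^sup>2"
    and x: "x0 \<in> cball c (3 * \<rho> / 4)" "x1 \<in> cball c (3 * \<rho> / 4)"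
    and y: "norm (y0 - y1) \<le> \<rho> / 4"
  shows "norm (y0 - y1) \<le> (bend + 32) * norm (x0 - x1)"
proof (rule ccontr)
  assume neg: "\<not> ?thesis"
  define d where "d = norm (y0 - y1)"
  have "0 \<le> (bend + 32) * norm (x0 - x1)" using bend_pos by simp
  with neg have d: "d > 0" unfolding d_def by linarith
  \<comment> \<open>The summand \<open>bend\<close> makes \<open>bend * r < d\<close>, so the drop
    \<open>a * d * r\<close> is large enough for the barrier; the summand 32 keeps the barrier's
    outer ball inside \<open>cball c \<rho>\<close>.\<close>
  define r where "r = d / (bend + 32)"
  have r: "0 < r" "(bend + 32) * r = d" using d bend_pos by (auto simp: r_def)
  have xr: "norm (x0 - x1) < r"
    using neg bend_pos by (simp add: r_def d_def field_simps)
  have "32 * r \<le> d" using r bend_pos by (simp add: algebra_simps flip: r(2))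
  then have r32: "32 * r \<le> \<rho> / 4" using y by (simp add: d_def)
  define e where "e = (1 / d) *\<^sub>R (y1 - y0)"
  have e: "norm e = 1" using d by (simp add: e_def d_def norm_minus_commute)
  have ye: "y1 - y0 = d *\<^sub>R e" using d by (simp add: e_def)
  \<comment> \<open>Moving by \<open>2 * r\<close> in the direction in which the first paraboloid
    rises relative to the second puts all of \<open>cball z r\<close> at height at least
    \<open>r\<close> above \<open>x1\<close>, while \<open>x0\<close> stays within
    \<open>3 * r\<close> of \<open>z\<close>.\<close>
  define z where "z = x1 + (2 * r) *\<^sub>R e"
  have "norm (x0 - z) \<le> norm (x0 - x1) + norm ((2 * r) *\<^sub>R e)"
    unfolding z_def using norm_triangle_ineq4[of "x0 - x1" "(2 * r) *\<^sub>R e"] by (simp add: algebra_simps)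
  then have x0z: "norm (x0 - z) \<le> 3 * r" using e r xr by simp
  have sub5: "cball z (5 * r) \<subseteq> cball c \<rho>"
  proof -
    have "dist z c \<le> dist z x1 + dist x1 c" by (rule dist_triangle)
    also have "dist z x1 = 2 * r" using e r by (simp add: z_def dist_norm)
    also have "dist x1 c \<le> 3 * \<rho> / 4" using x by (simp add: dist_commute)
    finally show ?thesis using r32 r by (subst cball_subset_cball_iff) auto
  qed
  have id: "(c0 + a / 2 * (norm (x - y0))\<^sup>2) - (c1 + a / 2 * (norm (x - y1))\<^sup>2)
      = (c0 + a / 2 * (norm (x1 - y0))\<^sup>2) - (c1 + a / 2 * (norm (x1 - y1))\<^sup>2) + a * d * ((x - x1) \<bullet> e)" for x
  proof -
    have "a * d * ((x - x1) \<bullet> e) = a * ((x - x1) \<bullet> (y1 - y0))" by (simp add: ye)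
    then show ?thesis
      unfolding power2_norm_eq_inner by (simp add: algebra_simps inner_commute)
  qed
  have x1c: "x1 \<in> cball c \<rho>" using x(2) r32 r by auto
  have "u x0 \<le> c0 + a / 2 * (norm (x0 - y0))\<^sup>2 - gap * (a * d * r)"
  proof (rule gaussian_barrier[OF sub cont f _ r(1)])
    show "cball z (5 * r) \<subseteq> S" using sub5 S by auto
    have "bend * r < d" using r by (simp add: algebra_simps flip: r(2))
    then have "a * r * (bend * r) < a * r * d" using r \<open>0 < a\<close> by (intro mult_strict_left_mono) auto
    then show "bend * a * r\<^sup>2 < a * d * r" by (simp add: power2_eq_square algebra_simps)
    show "u x \<le> c0 + a / 2 * (norm (x - y0))\<^sup>2" if "x \<in> cball z (5 * r)" for x
      using le0 that sub5 by blast
    show "x0 \<in> cball z (4 * r)" using x0z r by (auto simp: dist_norm norm_minus_commute)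
    show "u x \<le> c0 + a / 2 * (norm (x - y0))\<^sup>2 - a * d * r" if "x \<in> cball z r" for x
    proof -
      have "\<bar>(x - z) \<bullet> e\<bar> \<le> norm (x - z) * norm e" by (rule Cauchy_Schwarz_ineq2)
      also have "\<dots> \<le> r" using that e by (auto simp: dist_norm norm_minus_commute)
      finally have "(x - z) \<bullet> e \<ge> - r" by simp
      moreover have "(x - x1) \<bullet> e = (x - z) \<bullet> e + 2 * r * (e \<bullet> e)"
        by (simp add: z_def algebra_simps)
      moreover have "e \<bullet> e = 1" using e by (simp add: dot_square_norm)
      ultimately have "(x - x1) \<bullet> e \<ge> r" by simp
      then have "a * d * ((x - x1) \<bullet> e) \<ge> a * d * r" using \<open>0 < a\<close> d by simp
      moreover have "c0 + a / 2 * (norm (x1 - y0))\<^sup>2 \<ge> c1 + a / 2 * (norm (x1 - y1))\<^sup>2"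
        using le0[OF x1c] eq1 by simp
      moreover have "u x \<le> c1 + a / 2 * (norm (x - y1))\<^sup>2"
        using that r sub5 by (intro le1) (auto simp: subset_iff)
      ultimately show ?thesis using id[of x] by linarith
    qed
  qed (use \<open>0 < a\<close> in auto)
  moreover have "gap * (a * d * r) > 0" using gap_pos \<open>0 < a\<close> d r by simp
  ultimately show False using eq0 by linarith
qed

text \<open>The quotient of \<open>(1 / 8) ^ n\<close>, the volume fraction of the ball of vertices,
  and \<open>(5 * (bend + 32)) ^ n\<close>, the loss in passing from vertices to contact
  points.\<close>

definition theta :: "nat \<Rightarrow> real" where "theta n = (1 / (40 * (bend + 32))) ^ n"

lemma theta_pos: "theta n > 0"
  using bend_pos by (simp add: theta_def)

text \<open>Paraboloids with vertices in the ball of radius \<open>\<rho> / 8\<close> are slid down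
  until they touch \<open>u\<close>. The almost maximal value at \<open>w\<close> keeps every
  contact point interior, the subsolution inequality places it in \<open>W\<close>, and the map from
  vertices to contact points is expansive.\<close>

lemma contact_measure:
  fixes u f :: "real^'n \<Rightarrow> real"
  assumes sub: "subsol lam Lam f S u" and cont: "continuous_on S u"
    and f: "\<And>x. x \<in> S \<Longrightarrow> 0 \<le> f x" and S: "cball c \<rho> \<subseteq> S" and "0 < \<rho>" "0 < m"
    and le: "\<And>x. x \<in> cball c \<rho> \<Longrightarrow> u x \<le> M"
    and w: "w \<in> cball c (\<rho> / 4)" "M - u w \<le> m"
    and W: "W \<in> lmeasurable"
      "\<And>x. x \<in> ball c \<rho> \<Longrightarrow> M - u x \<le> 3 * m \<Longrightarrow> f x \<le> Lam * (16 * m / \<rho>\<^sup>2) \<Longrightarrow> x \<in> W"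
  shows "theta CARD('n) * measure lebesgue (ball c \<rho>) \<le> measure lebesgue W"
proof -
  \<comment> \<open>With \<open>a * \<rho>\<^sup>2 = 16 * m\<close> the paraboloid costs at most
    \<open>9 / 8 * m\<close> at \<open>w\<close> but at least \<open>25 / 8 * m\<close> outside
    radius \<open>3 * \<rho> / 4\<close>. The difference exceeds the deficit \<open>m\<close> at
    \<open>w\<close>, so no maximum occurs out there.\<close>
  define a where "a = 16 * m / \<rho>\<^sup>2"
  have a: "a > 0" "a * \<rho>\<^sup>2 = 16 * m" using \<open>0 < \<rho>\<close> \<open>0 < m\<close> by (auto simp: a_def)
  define V where "V = ball c (\<rho> / 8)"
  have contact: "\<exists>x. x \<in> ball c (3 * \<rho> / 4) \<and> x \<in> W \<and>
      (\<forall>x'\<in>cball c \<rho>. u x' \<le> (u x - a / 2 * (norm (x - y))\<^sup>2) + a / 2 * (norm (x' - y))\<^sup>2)"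
    if y: "y \<in> V" for y
  proof -
    \<comment> \<open>Height and rate zero reduce the test function of \<open>subsol\<close> to a
      pure paraboloid.\<close>
    define D where "D x = u x - (a / 2 * (norm (x - y))\<^sup>2 - 0 * exp (- 0 * (norm (x - y))\<^sup>2))" for x
    have Dx: "D x = u x - a / 2 * (norm (x - y))\<^sup>2" for x by (simp add: D_def)
    have "continuous_on (cball c \<rho>) D"
      unfolding D_def by (intro continuous_intros continuous_on_subset[OF cont S])
    then obtain x where x: "x \<in> cball c \<rho>" and xmax: "\<And>x'. x' \<in> cball c \<rho> \<Longrightarrow> D x' \<le> D x"
      using continuous_attains_sup[of "cball c \<rho>" D] \<open>0 < \<rho>\<close> by auto
    have wc: "w \<in> cball c \<rho>" using w \<open>0 < \<rho>\<close> by auto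
    have "norm (w - y) \<le> 3 * \<rho> / 8"
      using w y norm_triangle_ineq4[of "w - c" "y - c"] 
      by (auto simp: V_def dist_norm norm_minus_commute)
    then have "(norm (w - y))\<^sup>2 \<le> (3 * \<rho> / 8)\<^sup>2" by (intro power_mono) auto
    then have "a / 2 * (norm (w - y))\<^sup>2 \<le> a / 2 * (3 * \<rho> / 8)\<^sup>2" using a by (intro mult_left_mono) auto
    also have "\<dots> = 9 / 128 * (a * \<rho>\<^sup>2)" by (simp add: power2_eq_square)
    finally have Dw: "D w \<ge> M - 17 / 8 * m" using w by (simp add: Dx a)
    have D: "D w \<le> D x" using xmax wc by blast
    have ux: "u x \<le> M" using le x by blast
    have x34: "norm (x - c) < 3 * \<rho> / 4"
    proof (rule ccontr)
      assume "\<not> norm (x - c) < 3 * \<rho> / 4"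
      moreover have "norm (y - c) < \<rho> / 8" using y by (simp add: V_def dist_norm norm_minus_commute)
      ultimately have "5 * \<rho> / 8 \<le> norm (x - y)"
        using norm_triangle_ineq[of "x - y" "y - c"] by simp
      then have "(5 * \<rho> / 8)\<^sup>2 \<le> (norm (x - y))\<^sup>2" using \<open>0 < \<rho>\<close> by (intro power_mono) auto
      then have "a / 2 * (5 * \<rho> / 8)\<^sup>2 \<le> a / 2 * (norm (x - y))\<^sup>2" using a by (intro mult_left_mono) auto
      moreover have "a / 2 * (5 * \<rho> / 8)\<^sup>2 = 25 / 128 * (a * \<rho>\<^sup>2)" by (simp add: power2_eq_square)
      ultimately have "D x \<le> M - 25 / 8 * m" using ux a(2) Dx[of x] by linarith
      then show False using D Dw \<open>0 < m\<close> by linarith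
    qed
    have xS: "x \<in> S" using x S by auto
    have xb: "x \<in> ball c \<rho>" using x34 \<open>0 < \<rho>\<close> by (auto simp: dist_norm norm_minus_commute)
    have "loc_max_in S D x"
      unfolding loc_max_in_def
    proof (intro exI[of _ "\<rho> / 4"] conjI ballI)
      fix x' assume "x' \<in> S \<inter> ball x (\<rho> / 4)"
      then have "norm (x - x') < \<rho> / 4" by (auto simp: dist_norm)
      then have "x' \<in> cball c \<rho>"
        using x34 norm_triangle_ineq4[of "x - c" "x - x'"] by (auto simp: dist_norm norm_minus_commute)
      then show "D x' \<le> D x" by (rule xmax)
    qed (use \<open>0 < \<rho>\<close> in simp)
    then have "f x \<le> Lam * a"
      using subsolD[OF sub xS, of a 0 0] a unfolding D_def by simp
    moreover have "M - u x \<le> 3 * m"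
    proof -
      have "D x \<le> u x" using a by (simp add: Dx)
      then show ?thesis using D Dw \<open>0 < m\<close> by linarith
    qed
    ultimately have "x \<in> W" using W(2)[OF xb] by (simp add: a_def)
    moreover have "u x' \<le> (u x - a / 2 * (norm (x - y))\<^sup>2) + a / 2 * (norm (x' - y))\<^sup>2"
      if "x' \<in> cball c \<rho>" for x'
      using xmax[OF that] by (simp add: Dx)
    ultimately show ?thesis using x34 by (intro exI[of _ x]) (auto simp: dist_norm norm_minus_commute)
  qed
  then obtain h where h1: "\<And>y. y \<in> V \<Longrightarrow> h y \<in> ball c (3 * \<rho> / 4)" and h2: "\<And>y. y \<in> V \<Longrightarrow> h y \<in> W"
    and h3: "\<And>y x'. y \<in> V \<Longrightarrow> x'\<in>cball c \<rho> \<Longrightarrow>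
      u x' \<le> (u (h y) - a / 2 * (norm (h y - y))\<^sup>2) + a / 2 * (norm (x' - y))\<^sup>2"
    by metis
  have "measure lebesgue V \<le> (5 * (bend + 32)) ^ DIM(real^'n) * measure lebesgue W"
  proof (rule measure_le_expansive_image[where h = h])
    fix y y' assume y: "y \<in> V" "y' \<in> V"
    show "norm (y - y') \<le> (bend + 32) * norm (h y - h y')"
    proof (rule contact_expansive[OF sub cont f S a(1) h3[OF y(1)] h3[OF y(2)]])
      show "norm (y - y') \<le> \<rho> / 4"
        using y norm_triangle_ineq4[of "y - c" "y' - c"] by (auto simp: V_def dist_norm norm_minus_commute)
    qed (use h1 y in \<open>auto intro: less_imp_le\<close>)
  qed (use W h2 bend_pos in \<open>auto simp: V_def\<close>)
  then have V: "measure lebesgue V \<le> (5 * (bend + 32)) ^ CARD('n) * measure lebesgue W" by simp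
  have "measure lebesgue V = (1 / 8) ^ CARD('n) * measure lebesgue (ball c \<rho>)"
    using \<open>0 < \<rho>\<close> unfolding V_def by (simp only: measure_lebesgue_ball) (simp add: field_simps)
  with V have "(1 / 8) ^ CARD('n) * measure lebesgue (ball c \<rho>)
      \<le> (5 * (bend + 32)) ^ CARD('n) * measure lebesgue W" by simp
  then have "(1 / 8) ^ CARD('n) / (5 * (bend + 32)) ^ CARD('n) * measure lebesgue (ball c \<rho>)
      \<le> measure lebesgue W"
    using bend_pos by (simp add: field_simps)
  also have "(1 / 8) ^ CARD('n) / (5 * (bend + 32)) ^ CARD('n) = theta CARD('n)"
    unfolding theta_def by (subst power_divide[symmetric]) (simp add: field_simps)
  finally show ?thesis .
qed

section \<open>Decay of superlevel sets\<close>

lemma theta_less_1: "theta CARD('n::finite) < 1"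
  unfolding theta_def using bend_pos by (intro power_less_one_iff[THEN iffD2]) auto

text \<open>The barrier turns a deficit \<open>m\<close> into a deficit below
  \<open>2 * m / gap\<close> at a point near the centre, and the contact estimate triples that
  bound.\<close>

definition spread :: real where "spread = 6 / gap"

lemma spread_ge_1: "spread \<ge> 1"
proof -
  have "exp (- 16 * bt) \<le> 1" using bt_pos by simp
  then have "gap \<le> 1" unfolding gap_def using exp_gt_zero[of "- 25 * bt"] by linarith
  then show ?thesis using gap_pos by (simp add: spread_def field_simps)
qed

lemma lmeasurable_superlevel:
  fixes u :: "real^'n \<Rightarrow> real"
  assumes "continuous_on S u" "ball c r \<subseteq> S"
  shows "open {x \<in> ball c r. t < M - u x}" "{x \<in> ball c r. t < M - u x} \<in> lmeasurable"
proof -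
  have "open (ball c r \<inter> (\<lambda>x. M - u x) -` {t<..})"
    by (intro continuous_open_preimage continuous_intros continuous_on_subset[OF assms]) auto
  moreover have "ball c r \<inter> (\<lambda>x. M - u x) -` {t<..} = {x \<in> ball c r. t < M - u x}" by auto
  ultimately show "open {x \<in> ball c r. t < M - u x}" by simp
  then show "{x \<in> ball c r. t < M - u x} \<in> lmeasurable"
    by (intro lmeasurable_open bounded_subset[OF bounded_ball[of c r]]) auto
qed

text \<open>A small deficit \<open>M - u\<close> at one point of the ball first yields a point of
  controlled deficit near the centre; the contact estimate there makes the deficit controlled on the
  fraction \<open>theta\<close> of the ball.\<close>

lemma measure_superlevel_le:
  fixes u f :: "real^'n \<Rightarrow> real"
  assumes sub: "subsol lam Lam f S u" and cont: "continuous_on S u"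
    and f: "\<And>x. x \<in> S \<Longrightarrow> 0 \<le> f x" and S: "cball c (5 / 4 * r) \<subseteq> S" and "0 < r" "0 < m"
    and le: "\<And>x. x \<in> cball c (5 / 4 * r) \<Longrightarrow> u x \<le> M"
    and x0: "x0 \<in> ball c r" "M - u x0 \<le> m"
  shows "measure lebesgue {x \<in> ball c r. spread * m < M - u x}
    \<le> (1 - theta CARD('n)) * measure lebesgue (ball c r)"
proof -
  have rS: "cball c r \<subseteq> S" using S \<open>0 < r\<close> by (auto simp: subset_iff)
  \<comment> \<open>This is the barrier with opening 0 and inner radius \<open>r / 4\<close>, read
    contrapositively: deficit \<open>2 * m / gap\<close> throughout the small ball would force
    deficit \<open>2 * m\<close> at \<open>x0\<close>.\<close>
  have "\<exists>w\<in>cball c (r / 4). M - u w < 2 * m / gap"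
  proof (rule ccontr)
    assume "\<not> ?thesis"
    then have far: "u x \<le> M + 0 / 2 * (norm (x - c))\<^sup>2 - 2 * m / gap" if "x \<in> cball c (r / 4)" for x
      using that by force
    have "u x0 \<le> M + 0 / 2 * (norm (x0 - c))\<^sup>2 - gap * (2 * m / gap)"
      by (rule gaussian_barrier[OF sub cont f, where r = "r / 4" and z = c])
        (use S le far x0 \<open>0 < r\<close> \<open>0 < m\<close> gap_pos in auto)
    then show False using x0 \<open>0 < m\<close> gap_pos by simp
  qed
  then obtain w where w: "w \<in> cball c (r / 4)" "M - u w < 2 * m / gap" by blast
  let ?E = "{x \<in> ball c r. spread * m < M - u x}"
  have E: "?E \<in> lmeasurable"
    using lmeasurable_superlevel(2)[OF cont] rS ball_subset_cball by blast
  have "theta CARD('n) * measure lebesgue (ball c r) \<le> measure lebesgue (ball c r - ?E)"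
  proof (rule contact_measure[OF sub cont f rS \<open>0 < r\<close>, where w = w and m = "2 * m / gap"])
    show "ball c r - ?E \<in> lmeasurable" using E by (intro fmeasurable.Diff) auto
    show "u x \<le> M" if "x \<in> cball c r" for x using that \<open>0 < r\<close> by (intro le) auto
    show "x \<in> ball c r - ?E" if "x \<in> ball c r" "M - u x \<le> 3 * (2 * m / gap)" for x
      using that by (auto simp: spread_def)
  qed (use w \<open>0 < m\<close> gap_pos in auto)
  also have "\<dots> = measure lebesgue (ball c r) - measure lebesgue ?E"
    using E by (intro measurable_measure_Diff) (auto intro: fmeasurableD)
  finally show ?thesis by (simp add: algebra_simps)
qed

text \<open>The growth factor of \<open>ink_spots\<close> for
  \<open>mu = theta n / 2\<close>.\<close>

definition decay :: "nat \<Rightarrow> real" where "decay n = 1 + theta n / 2 / 5 ^ n"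

lemma decay_gt_1: "decay n > 1"
  using theta_pos by (simp add: decay_def)

text \<open>By \<open>measure_superlevel_le\<close>, a ball in which the deficit exceeds
  \<open>spread * m\<close> on a very large fraction contains no point of deficit at most
  \<open>m\<close>. This is the filling condition of \<open>ink_spots\<close>.\<close>

lemma measure_superlevel_step:
  fixes u f :: "real^'n \<Rightarrow> real"
  assumes sub: "subsol lam Lam f S u" and cont: "continuous_on S u"
    and f: "\<And>x. x \<in> S \<Longrightarrow> 0 \<le> f x" and S: "cball c (3 * r) \<subseteq> S" and "0 < r" "0 < m"
    and le: "\<And>x. x \<in> cball c (3 * r) \<Longrightarrow> u x \<le> M"
    and c: "M - u c \<le> m"
  shows "decay CARD('n) * measure lebesgue {x \<in> ball c r. spread * m < M - u x}
    \<le> measure lebesgue {x \<in> ball c r. m < M - u x}"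
proof -
  let ?E = "{x \<in> ball c r. spread * m < M - u x}"
  have rS: "ball c r \<subseteq> S" using S \<open>0 < r\<close> by (auto simp: subset_iff)
  have th: "0 < theta CARD('n)" "theta CARD('n) < 1"
    using theta_pos theta_less_1[where 'n='n] by auto
  \<comment> \<open>Halving \<open>theta\<close> makes the bound strict. It serves twice: at the
    whole ball, with \<open>x0 = c\<close>, and contrapositively at the balls to be filled.\<close>
  have gen: "measure lebesgue (ball z s \<inter> ?E) < (1 - theta CARD('n) / 2) * measure lebesgue (ball z s)"
    if z: "0 < s" "ball z s \<subseteq> ball c r" "x0 \<in> ball z s" "M - u x0 \<le> m" for z s x0
  proof -
    have "cball z s \<subseteq> cball c r" using z \<open>0 < r\<close>
      by (metis closure_ball closure_mono less_irrefl)
    then have zs: "dist z c + s \<le> r" using z \<open>0 < r\<close> by (simp add: cball_subset_cball_iff)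
    then have "dist z c + 5 / 4 * s \<le> 3 * r"
      using z(1) zero_le_dist[of z c] by linarith
    then have sub3: "cball z (5 / 4 * s) \<subseteq> cball c (3 * r)"
      by (simp add: cball_subset_cball_iff)
    have "ball z s \<inter> ?E = {x \<in> ball z s. spread * m < M - u x}" using z by auto
    moreover have "measure lebesgue {x \<in> ball z s. spread * m < M - u x}
        \<le> (1 - theta CARD('n)) * measure lebesgue (ball z s)"
    proof (rule measure_superlevel_le[OF sub cont f _ z(1) \<open>0 < m\<close> _ z(3,4)])
      show "cball z (5 / 4 * s) \<subseteq> S" using sub3 S by (rule order_trans)
      show "u x \<le> M" if "x \<in> cball z (5 / 4 * s)" for x using that sub3 by (intro le) blast
    qed
    ultimately have "measure lebesgue (ball z s \<inter> ?E)
        \<le> (1 - theta CARD('n)) * measure lebesgue (ball z s)" by simp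
    also have "measure lebesgue (ball z s) > 0" 
      using z(1) by (simp only: measure_lebesgue_ball) simp
    then have "(1 - theta CARD('n)) * measure lebesgue (ball z s)
        < (1 - theta CARD('n) / 2) * measure lebesgue (ball z s)"
      using th by (intro mult_strict_right_mono) auto
    finally show ?thesis .
  qed
  have "(1 + theta CARD('n) / 2 / 5 ^ DIM(real^'n)) * measure lebesgue ?E
      \<le> measure lebesgue {x \<in> ball c r. m < M - u x}"
  proof (rule ink_spots[where c = c and R = r])
    have "ball c r \<inter> ?E = ?E" by blast
    moreover have "c \<in> ball c r" using \<open>0 < r\<close> by simp
    note gen[OF \<open>0 < r\<close> subset_refl this c]
    ultimately show "measure lebesgue ?E < (1 - theta CARD('n) / 2) * measure lebesgue (ball c r)"
      by (simp only:)
  next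
    fix z s assume z: "0 < s" "ball z s \<subseteq> ball c r"
      "(1 - theta CARD('n) / 2) * measure lebesgue (ball z s) \<le> measure lebesgue (ball z s \<inter> ?E)"
    show "ball z s \<subseteq> {x \<in> ball c r. m < M - u x}"
    proof
      fix x assume x: "x \<in> ball z s"
      have "m < M - u x"
      proof (rule ccontr)
        assume "\<not> m < M - u x"
        then have "M - u x \<le> m" by simp
        from gen[OF z(1,2) x this] z(3) show False by (simp only: not_less)
      qed
      then show "x \<in> {x \<in> ball c r. m < M - u x}" using x z(2) by blast
    qed
  qed (use th lmeasurable_superlevel[OF cont rS] in auto)
  then show ?thesis by (simp add: decay_def)
qed

text \<open>The step is iterated along geometrically growing levels; the condition at the centre
  persists because \<open>spread\<close> is at least 1.\<close>

lemma measure_superlevel_decay: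
  fixes u f :: "real^'n \<Rightarrow> real"
  assumes sub: "subsol lam Lam f S u" and cont: "continuous_on S u"
    and f: "\<And>x. x \<in> S \<Longrightarrow> 0 \<le> f x" and S: "cball c (3 * r) \<subseteq> S" and "0 < r" "0 < m"
    and le: "\<And>x. x \<in> cball c (3 * r) \<Longrightarrow> u x \<le> M"
    and c: "M - u c \<le> m"
  shows "decay CARD('n) ^ k * measure lebesgue {x \<in> ball c r. spread ^ k * m < M - u x}
    \<le> measure lebesgue (ball c r)"
proof (induction k)
  case 0
  have "ball c r \<subseteq> S" using S \<open>0 < r\<close> by (auto simp: subset_iff)
  then have "measure lebesgue {x \<in> ball c r. m < M - u x} \<le> measure lebesgue (ball c r)"
    using lmeasurable_superlevel(2)[OF cont, of c r m M]
    by (intro measure_mono_fmeasurable fmeasurableD) auto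
  then show ?case by simp
next
  case (Suc k)
  have "m \<le> spread ^ k * m"
    using one_le_power[OF spread_ge_1, of k] \<open>0 < m\<close> by simp
  moreover from this have "0 < spread ^ k * m" using \<open>0 < m\<close> by linarith
  ultimately have step: "decay CARD('n) * measure lebesgue {x \<in> ball c r. spread * (spread ^ k * m) < M - u x}
      \<le> measure lebesgue {x \<in> ball c r. spread ^ k * m < M - u x}"
    using measure_superlevel_step[OF sub cont f S \<open>0 < r\<close> _ le] c order_trans by blast
  have "decay CARD('n) ^ Suc k * measure lebesgue {x \<in> ball c r. spread ^ Suc k * m < M - u x}
      = decay CARD('n) ^ k * (decay CARD('n) * measure lebesgue {x \<in> ball c r. spread * (spread ^ k * m) < M - u x})"
    by (simp only: power_Suc mult_ac)
  also have "\<dots> \<le> decay CARD('n) ^ k * measure lebesgue {x \<in> ball c r. spread ^ k * m < M - u x}"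
    by (rule mult_left_mono[OF step]) (use decay_gt_1[of "CARD('n)"] in simp)
  also note Suc
  finally show ?case .
qed

text \<open>If the bound failed, the points where paraboloids touch \<open>v\<close> from above
  would all lie where \<open>u < M / 2\<close>. They fill the fraction \<open>theta\<close> of the
  ball, whereas an almost maximal value of \<open>u\<close> at the centre makes that set
  smaller.\<close>

lemma almost_max_lower_bound:
  obtains \<kappa> where "0 < \<kappa>" "\<kappa> \<le> 1 / 2" "\<And>(f :: real^'n \<Rightarrow> real) g S u v c r M q \<delta>.
     subsol lam Lam f S u \<Longrightarrow> subsol lam Lam g S v \<Longrightarrow> continuous_on S u \<Longrightarrow> continuous_on S v \<Longrightarrow>
     \<forall>x\<in>S. 0 \<le> f x \<Longrightarrow> \<forall>x\<in>S. pospow (u x) q \<le> g x \<Longrightarrow> \<forall>x\<in>S. 0 \<le> v x \<Longrightarrow>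
     0 \<le> q \<Longrightarrow> 0 < r \<Longrightarrow> 0 < M \<Longrightarrow> 0 < \<delta> \<Longrightarrow> cball c (3 * r) \<subseteq> S \<Longrightarrow>
     \<forall>x\<in>cball c (3 * r). u x \<le> M \<and> v x \<le> \<delta> \<Longrightarrow> (1 - \<kappa>) * M \<le> u c \<Longrightarrow>
     (M / 2) powr q \<le> 16 * Lam * \<delta> / r\<^sup>2"
proof -
  let ?n = "CARD('n)"
  \<comment> \<open>So many steps of decay bring the measure fraction below
    \<open>theta\<close>.\<close>
  obtain k where k: "1 / theta ?n < decay ?n ^ k"
    using real_arch_pow[OF decay_gt_1] by blast
  \<comment> \<open>Chosen so that the initial deficit \<open>\<kappa> * M\<close> has grown to
    exactly \<open>M / 2\<close> after \<open>k\<close> steps.\<close>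
  define \<kappa> where "\<kappa> = 1 / (2 * spread ^ k)"
  have sk: "spread ^ k \<ge> 1" using spread_ge_1 by (rule one_le_power)
  then have \<kappa>: "0 < \<kappa>" "\<kappa> \<le> 1 / 2" "spread ^ k * \<kappa> = 1 / 2"
    using spread_ge_1 by (auto simp: \<kappa>_def field_simps)
  have "(M / 2) powr q \<le> 16 * Lam * \<delta> / r\<^sup>2"
    if sub: "subsol lam Lam f S u" "subsol lam Lam g S v" and cont: "continuous_on S u" "continuous_on S v"
    and f: "\<forall>x\<in>S. 0 \<le> f x" and g: "\<forall>x\<in>S. pospow (u x) q \<le> g x" and v: "\<forall>x\<in>S. 0 \<le> v x"
    and pos: "0 \<le> q" "0 < r" "0 < M" "0 < \<delta>" and S: "cball c (3 * r) \<subseteq> S"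
    and le: "\<forall>x\<in>cball c (3 * r). u x \<le> M \<and> v x \<le> \<delta>" and uc: "(1 - \<kappa>) * M \<le> u c"
    for f g S and u v :: "real^'n \<Rightarrow> real" and c r M q \<delta>
  proof (rule ccontr)
    assume neg: "\<not> ?thesis"
    let ?E = "{x \<in> ball c r. M / 2 < M - u x}"
    have rS: "cball c r \<subseteq> S" using S pos by (auto simp: subset_iff)
    have bS: "ball c r \<subseteq> S" using rS ball_subset_cball by blast
    have "c \<in> S" using rS pos by (simp add: subset_iff)
    then have vc: "0 \<le> v c" using v by blast
    have "decay ?n ^ k * measure lebesgue {x \<in> ball c r. spread ^ k * (\<kappa> * M) < M - u x}
        \<le> measure lebesgue (ball c r)"
      by (rule measure_superlevel_decay[OF sub(1) cont(1) _ S])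
         (use f le uc pos \<kappa> in \<open>auto simp: algebra_simps\<close>)
    moreover have "spread ^ k * (\<kappa> * M) = M / 2" using \<kappa>(3) by (simp flip: mult.assoc)
    ultimately have 1: "decay ?n ^ k * measure lebesgue ?E \<le> measure lebesgue (ball c r)" by simp
    have 2: "theta ?n * measure lebesgue (ball c r) \<le> measure lebesgue ?E"
    \<comment> \<open>The centre is an admissible \<open>w\<close>: since \<open>v\<close> is
      non-negative, its deficit from the upper bound \<open>\<delta>\<close> is at most
      \<open>\<delta>\<close>.\<close>
    proof (rule contact_measure[OF sub(2) cont(2) _ rS, where w = c and m = \<delta> and M = \<delta>])
      show "0 \<le> g x" if "x \<in> S" for x
      proof -
        have "0 \<le> pospow (u x) q" by (simp add: pospow_def)
        with g that show ?thesis by force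
      qed
      show "?E \<in> lmeasurable" using lmeasurable_superlevel(2)[OF cont(1) bS] .
      show "x \<in> ?E" if x: "x \<in> ball c r" "g x \<le> Lam * (16 * \<delta> / r\<^sup>2)" for x
      proof (rule ccontr)
        assume "x \<notin> ?E"
        then have "M / 2 \<le> max (u x) 0" using x by auto
        then have "(M / 2) powr q \<le> pospow (u x) q"
          unfolding pospow_def using pos by (intro powr_mono2) auto
        also have "\<dots> \<le> g x" using g x bS by blast
        also note x(2)
        finally show False using neg by (simp add: mult_ac)
      qed
    qed (use pos le vc in auto)
    have th: "theta ?n > 0" by (rule theta_pos)
    have "measure lebesgue (ball c r) > 0" using pos by (simp only: measure_lebesgue_ball) simp
    then have "0 < theta ?n * measure lebesgue (ball c r)" using th by simp
    with 2 have E0: "0 < measure lebesgue ?E" by linarith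
    have "1 / theta ?n * measure lebesgue ?E < decay ?n ^ k * measure lebesgue ?E"
      using k E0 by (rule mult_strict_right_mono)
    with 1 have "1 / theta ?n * measure lebesgue ?E < measure lebesgue (ball c r)" by linarith
    with 2 th show False by (simp add: field_simps)
  qed
  with \<kappa>(1,2) show ?thesis by (rule that)
qed

text \<open>An almost maximal point is produced by maximising \<open>u\<close> times the distance to
  the boundary of the ball: around the maximiser \<open>u\<close> cannot increase much. The bound
  \<open>K * M\<close> keeps the maximiser away from the boundary.\<close>

lemma doubling_lower_bound:
  assumes "0 \<le> q" "1 \<le> K"
  obtains C where "0 < C" "\<And>(f :: real^'n \<Rightarrow> real) g S u v y r x0 M \<delta>.
     subsol lam Lam f S u \<Longrightarrow> subsol lam Lam g S v \<Longrightarrow> continuous_on S u \<Longrightarrow> continuous_on S v \<Longrightarrow>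
     \<forall>x\<in>S. 0 \<le> f x \<Longrightarrow> \<forall>x\<in>S. pospow (u x) q \<le> g x \<Longrightarrow> \<forall>x\<in>S. 0 \<le> v x \<Longrightarrow>
     0 < r \<Longrightarrow> 0 < M \<Longrightarrow> 0 < \<delta> \<Longrightarrow> cball y r \<subseteq> S \<Longrightarrow> x0 \<in> cball y (r / 2) \<Longrightarrow> M \<le> u x0 \<Longrightarrow>
     \<forall>x\<in>cball y r. u x \<le> K * M \<and> v x \<le> \<delta> \<Longrightarrow> C * M powr q * r\<^sup>2 \<le> \<delta>"
proof -
  obtain \<kappa> where \<kappa>: "0 < \<kappa>" "\<kappa> \<le> 1 / 2" and main: "\<And>(f :: real^'n \<Rightarrow> real) g S u v c r M q \<delta>.
     subsol lam Lam f S u \<Longrightarrow> subsol lam Lam g S v \<Longrightarrow> continuous_on S u \<Longrightarrow> continuous_on S v \<Longrightarrow>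
     \<forall>x\<in>S. 0 \<le> f x \<Longrightarrow> \<forall>x\<in>S. pospow (u x) q \<le> g x \<Longrightarrow> \<forall>x\<in>S. 0 \<le> v x \<Longrightarrow>
     0 \<le> q \<Longrightarrow> 0 < r \<Longrightarrow> 0 < M \<Longrightarrow> 0 < \<delta> \<Longrightarrow> cball c (3 * r) \<subseteq> S \<Longrightarrow>
     \<forall>x\<in>cball c (3 * r). u x \<le> M \<and> v x \<le> \<delta> \<Longrightarrow> (1 - \<kappa>) * M \<le> u c \<Longrightarrow>
     (M / 2) powr q \<le> 16 * Lam * \<delta> / r\<^sup>2"
    by (rule almost_max_lower_bound[where 'n='n]) blast
  \<comment> \<open>This rearranges
    \<open>(M / 4) powr q * R\<^sup>2 \<le> 16 * Lam * \<delta>\<close> together with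
    \<open>R \<ge> \<kappa> / (6 * K) * r\<close>.\<close>
  define C where "C = (1 / 4) powr q * (\<kappa> / (6 * K))\<^sup>2 / (16 * Lam)"
  have C: "C > 0" using \<kappa> lam assms by (simp add: C_def)
  have "C * M powr q * r\<^sup>2 \<le> \<delta>"
    if sub: "subsol lam Lam f S u" "subsol lam Lam g S v" and cont: "continuous_on S u" "continuous_on S v"
    and f: "\<forall>x\<in>S. 0 \<le> f x" and g: "\<forall>x\<in>S. pospow (u x) q \<le> g x" and v: "\<forall>x\<in>S. 0 \<le> v x"
    and pos: "0 < r" "0 < M" "0 < \<delta>" and S: "cball y r \<subseteq> S"
    and x0: "x0 \<in> cball y (r / 2)" "M \<le> u x0"
    and le: "\<forall>x\<in>cball y r. u x \<le> K * M \<and> v x \<le> \<delta>"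
    for f g S and u v :: "real^'n \<Rightarrow> real" and y r x0 M \<delta>
  proof -
    have "continuous_on (cball y r) (\<lambda>x. u x * (r - dist x y))"
      by (intro continuous_intros continuous_on_subset[OF cont(1) S])
    then obtain c where c: "c \<in> cball y r"
      and cmax: "\<And>x. x \<in> cball y r \<Longrightarrow> u x * (r - dist x y) \<le> u c * (r - dist c y)"
      using continuous_attains_sup[of "cball y r" "\<lambda>x. u x * (r - dist x y)"] pos by auto
    define d where "d = r - dist c y"
    have d: "0 \<le> d" "d \<le> r" using c by (auto simp: d_def dist_commute)
    have "M * (r / 2) \<le> u x0 * (r - dist x0 y)"
      using x0 pos by (intro mult_mono) (auto simp: dist_commute)
    also have "\<dots> \<le> u c * d" unfolding d_def using x0 pos by (intro cmax) auto
    finally have ucd: "M * (r / 2) \<le> u c * d" .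
    moreover have "0 < M * (r / 2)" using pos by simp
    ultimately have "0 < u c * d" by linarith
    then have d0: "0 < d" and uc0: "0 < u c" using d(1) by (auto simp: zero_less_mult_iff)
    have "u c * d \<le> (K * M) * d" using le c d by (intro mult_right_mono) auto
    with ucd have "M * (r / 2) \<le> M * (K * d)" by (simp add: mult_ac)
    then have rK: "r / 2 \<le> K * d" using pos by simp
    have "u c * d \<le> u c * r" using uc0 d by simp
    with ucd have "M * (r / 2) \<le> u c * r" by linarith
    then have ucM: "M / 2 \<le> u c" using pos by (simp add: field_simps)
    \<comment> \<open>On the ball of radius \<open>3 * R = \<kappa> * d\<close> the weight is at
      least \<open>(1 - \<kappa>) * d\<close>, so maximality of \<open>c\<close> gives
      \<open>u x \<le> M'\<close> there, and \<open>u c\<close> is the fraction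
      \<open>1 - \<kappa>\<close> of \<open>M'\<close>.\<close>
    define R where "R = \<kappa> * d / 3"
    define M' where "M' = u c / (1 - \<kappa>)"
    have R: "R > 0" using \<kappa> d0 by (simp add: R_def)
    have M': "M' \<ge> M / 2" "M' > 0" "(1 - \<kappa>) * M' = u c"
    proof -
      have "u c \<le> M'" unfolding M'_def using \<kappa> uc0 by (simp add: field_simps)
      then show "M' \<ge> M / 2" "M' > 0" using ucM uc0 by auto
      show "(1 - \<kappa>) * M' = u c" using \<kappa> by (simp add: M'_def)
    qed
    have sub3: "cball c (3 * R) \<subseteq> cball y r"
    proof -
      have "\<kappa> * d \<le> d" using \<kappa> d0 by simp
      then show ?thesis using R d0 by (subst cball_subset_cball_iff) (simp add: R_def d_def)
    qed
    have u3: "u x \<le> M'" if x: "x \<in> cball c (3 * R)" for x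
    proof (cases "u x \<le> 0")
      case True then show ?thesis using M' by linarith
    next
      case False
      have "dist x y \<le> dist x c + dist c y" by (rule dist_triangle)
      also have "dist x c \<le> \<kappa> * d" using x by (simp add: R_def dist_commute)
      finally have "(1 - \<kappa>) * d \<le> r - dist x y" by (simp add: d_def algebra_simps)
      then have "u x * ((1 - \<kappa>) * d) \<le> u x * (r - dist x y)" using False by simp
      also have "\<dots> \<le> u c * d" unfolding d_def using x sub3 by (intro cmax) auto
      finally have "u x * (1 - \<kappa>) \<le> u c" using d0 by (simp flip: mult.assoc)
      then show ?thesis using \<kappa> by (simp add: M'_def field_simps)
    qed
    have "(M / 4) powr q \<le> (M' / 2) powr q"
      using M' pos assms by (intro powr_mono2) auto
    also have "\<dots> \<le> 16 * Lam * \<delta> / R\<^sup>2"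
      by (rule main[OF sub cont f g v assms(1) R M'(2) pos(3), of c])
         (use sub3 S le u3 M'(3) in auto)
    finally have "(M / 4) powr q * R\<^sup>2 \<le> 16 * Lam * \<delta>" using R by (simp add: field_simps)
    moreover have "(M / 4) powr q * (\<kappa> / (6 * K) * r)\<^sup>2 \<le> (M / 4) powr q * R\<^sup>2"
    proof (intro mult_left_mono power_mono)
      have "\<kappa> * (r / 2) \<le> \<kappa> * (K * d)" using rK \<kappa> by (intro mult_left_mono) auto
      then show "\<kappa> / (6 * K) * r \<le> R" using assms by (simp add: R_def field_simps)
    qed (use \<kappa> assms pos in auto)
    ultimately have "(M / 4) powr q * (\<kappa> / (6 * K) * r)\<^sup>2 \<le> 16 * Lam * \<delta>" by linarith
    moreover have "(M / 4) powr q = (1 / 4) powr q * M powr q"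
      using pos by (simp add: powr_divide)
    ultimately have "(1 / 4) powr q * M powr q * (\<kappa> / (6 * K))\<^sup>2 * r\<^sup>2 \<le> 16 * Lam * \<delta>"
      by (simp only: power_mult_distrib mult.assoc)
    then have "((1 / 4) powr q * M powr q * (\<kappa> / (6 * K))\<^sup>2 * r\<^sup>2) / (16 * Lam) \<le> \<delta>"
      using lam by (simp add: divide_le_eq mult.commute)
    then show ?thesis by (simp add: C_def mult_ac)
  qed
  with C show ?thesis by (rule that)
qed

section \<open>Growth of the system\<close>

text \<open>The exponents are those for which both doubling bounds are scale invariant:
  \<open>\<alpha> * q + 2 = \<beta>\<close> and \<open>\<beta> * p + 2 = \<alpha>\<close>. Growth at
  scale \<open>s / 2\<close> without growth at scale \<open>s\<close> is exactly a doubling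
  situation, and it contradicts the choice of \<open>c1\<close> and \<open>c2\<close>.\<close>

lemma dichotomy_growth:
  fixes p q :: real
  assumes pq: "0 \<le> p" "0 \<le> q" "p * q < 1"
  defines "\<alpha> \<equiv> 2 * (1 + p) / (1 - p * q)" and "\<beta> \<equiv> 2 * (1 + q) / (1 - p * q)"
  obtains c1 c2 where "0 < c1" "0 < c2" "\<And>S (u :: real^'n \<Rightarrow> real) v y r.
     subsol lam Lam (\<lambda>x. pospow (v x) p) S u \<Longrightarrow> subsol lam Lam (\<lambda>x. pospow (u x) q) S v \<Longrightarrow>
     continuous_on S u \<Longrightarrow> continuous_on S v \<Longrightarrow> \<forall>x\<in>S. 0 \<le> u x \<and> 0 \<le> v x \<Longrightarrow>
     0 < u y \<or> 0 < v y \<Longrightarrow> 0 < r \<Longrightarrow> cball y r \<subseteq> S \<Longrightarrow>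
     (\<exists>x\<in>cball y r. c1 * r powr \<alpha> \<le> u x) \<or> (\<exists>x\<in>cball y r. c2 * r powr \<beta> \<le> v x)"
proof -
  have ab: "0 < \<alpha>" "0 < \<beta>" "\<alpha> * q + 2 = \<beta>" "\<beta> * p + 2 = \<alpha>"
    using pq by (auto simp: \<alpha>_def \<beta>_def field_simps)
  have K: "1 \<le> (2::real) powr \<alpha>" "1 \<le> (2::real) powr \<beta>"
    using ab by (auto intro: ge_one_powr_ge_zero)
  obtain C where C: "C > 0" "\<And>(f :: real^'n \<Rightarrow> real) g S u v y r x0 M \<delta>.
     subsol lam Lam f S u \<Longrightarrow> subsol lam Lam g S v \<Longrightarrow> continuous_on S u \<Longrightarrow> continuous_on S v \<Longrightarrow>
     \<forall>x\<in>S. 0 \<le> f x \<Longrightarrow> \<forall>x\<in>S. pospow (u x) q \<le> g x \<Longrightarrow> \<forall>x\<in>S. 0 \<le> v x \<Longrightarrow>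
     0 < r \<Longrightarrow> 0 < M \<Longrightarrow> 0 < \<delta> \<Longrightarrow> cball y r \<subseteq> S \<Longrightarrow> x0 \<in> cball y (r / 2) \<Longrightarrow> M \<le> u x0 \<Longrightarrow>
     \<forall>x\<in>cball y r. u x \<le> 2 powr \<alpha> * M \<and> v x \<le> \<delta> \<Longrightarrow> C * M powr q * r\<^sup>2 \<le> \<delta>"
    by (rule doubling_lower_bound[OF pq(2) K(1), where 'n='n]) blast
  obtain C' where C': "C' > 0" "\<And>(f :: real^'n \<Rightarrow> real) g S u v y r x0 M \<delta>.
     subsol lam Lam f S u \<Longrightarrow> subsol lam Lam g S v \<Longrightarrow> continuous_on S u \<Longrightarrow> continuous_on S v \<Longrightarrow>
     \<forall>x\<in>S. 0 \<le> f x \<Longrightarrow> \<forall>x\<in>S. pospow (u x) p \<le> g x \<Longrightarrow> \<forall>x\<in>S. 0 \<le> v x \<Longrightarrow>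
     0 < r \<Longrightarrow> 0 < M \<Longrightarrow> 0 < \<delta> \<Longrightarrow> cball y r \<subseteq> S \<Longrightarrow> x0 \<in> cball y (r / 2) \<Longrightarrow> M \<le> u x0 \<Longrightarrow>
     \<forall>x\<in>cball y r. u x \<le> 2 powr \<beta> * M \<and> v x \<le> \<delta> \<Longrightarrow> C' * M powr p * r\<^sup>2 \<le> \<delta>"
    by (rule doubling_lower_bound[OF pq(1) K(2), where 'n='n]) blast
  \<comment> \<open>The final factor 1/2 makes the doubling bound exceed the threshold by a factor
    2, so the contradiction is strict.\<close>
  define A where "A = C * (1 / 2) powr (\<alpha> * q) / 2"
  define A' where "A' = C' * (1 / 2) powr (\<beta> * p) / 2"
  have A: "A > 0" "A' > 0" using C(1) C'(1) by (auto simp: A_def A'_def)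
  \<comment> \<open>\<open>c1\<close> and \<open>c2\<close> solve \<open>c2 = A * c1 powr q\<close>
    and \<open>c1 = A' * c2 powr p\<close>; eliminating \<open>c2\<close> leaves
    \<open>c1 powr (1 - p * q) = A powr p * A'\<close>, where \<open>p * q < 1\<close> allows taking
    the root.\<close>
  define c1 where "c1 = (A powr p * A') powr (1 / (1 - p * q))"
  define c2 where "c2 = A * c1 powr q"
  have c: "c1 > 0" "c2 > 0" using A by (auto simp: c1_def c2_def)
  have c1eq: "c1 = A' * c2 powr p"
  proof -
    have "c1 powr (1 - p * q) = A powr p * A'"
      using A pq by (simp add: c1_def powr_powr)
    then have "c1 powr (1 - p * q) * c1 powr (q * p) = A powr p * A' * c1 powr (q * p)" by simp
    then show ?thesis
      using c A by (simp add: c2_def powr_mult powr_powr mult_ac flip: powr_add)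
  qed
  have scale: "(k * (r / 2) powr a) powr s = k powr s * (1 / 2) powr (a * s) * r powr (a * s)"
    if "0 < k" "0 < r" for k r a s :: real
    using that by (simp add: powr_mult powr_powr powr_divide)
  define P where "P u v y r \<longleftrightarrow> (\<exists>x\<in>cball y r. c1 * r powr \<alpha> \<le> u x) \<or> (\<exists>x\<in>cball y r. c2 * r powr \<beta> \<le> v x)"
    for u v :: "real^'n \<Rightarrow> real" and y r
  have "P u v y r"
    if sub: "subsol lam Lam (\<lambda>x. pospow (v x) p) S u" "subsol lam Lam (\<lambda>x. pospow (u x) q) S v"
    and cont: "continuous_on S u" "continuous_on S v" and nn: "\<forall>x\<in>S. 0 \<le> u x \<and> 0 \<le> v x"
    and y: "0 < u y \<or> 0 < v y" and r: "0 < r" "cball y r \<subseteq> S"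
    for S and u v :: "real^'n \<Rightarrow> real" and y r
  proof -
    have up: "P u v y s" if s: "0 < s" "s \<le> r" and half: "P u v y (s / 2)" for s
    proof (rule ccontr)
      assume "\<not> P u v y s"
      then have neg: "\<And>x. x \<in> cball y s \<Longrightarrow> u x < c1 * s powr \<alpha>" "\<And>x. x \<in> cball y s \<Longrightarrow> v x < c2 * s powr \<beta>"
        unfolding P_def by force+
      have sS: "cball y s \<subseteq> S" using s r by (meson order_trans subset_cball)
      have pp: "\<forall>x\<in>S. 0 \<le> pospow (v x) p" "\<forall>x\<in>S. 0 \<le> pospow (u x) q" by (auto simp: pospow_def)
      have nn': "\<forall>x\<in>S. 0 \<le> u x" "\<forall>x\<in>S. 0 \<le> v x" using nn by auto
      \<comment> \<open>The failed threshold at scale \<open>s\<close> is \<open>2 powr a\<close>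
        times the attained one at scale \<open>s / 2\<close>, which is the constant \<open>K\<close>
        of the doubling bound.\<close>
      have dbl: "2 powr a * (k * (s / 2) powr a) = k * s powr a" for a k :: real
        using s by (simp add: powr_divide)
      have "(\<exists>x\<in>cball y (s / 2). c1 * (s / 2) powr \<alpha> \<le> u x) \<or> (\<exists>x\<in>cball y (s / 2). c2 * (s / 2) powr \<beta> \<le> v x)"
        using half by (simp add: P_def)
      then show False
      proof (elim disjE bexE)
        fix x assume x: "x \<in> cball y (s / 2)" "c1 * (s / 2) powr \<alpha> \<le> u x"
        have "C * (c1 * (s / 2) powr \<alpha>) powr q * s\<^sup>2 \<le> c2 * s powr \<beta>"
          by (rule C(2)[OF sub cont pp(1) _ nn'(2) s(1) _ _ sS x])
             (use c s neg in \<open>auto simp: dbl intro: less_imp_le\<close>)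
        then have "C * c1 powr q * (1 / 2) powr (\<alpha> * q) * (s powr (\<alpha> * q) * s powr 2) \<le> c2 * s powr \<beta>"
          using c s by (simp only: scale powr_numeral mult_ac)
        then have "2 * (A * c1 powr q) * s powr \<beta> \<le> c2 * s powr \<beta>"
          unfolding powr_add[symmetric] ab(3) by (simp add: A_def mult_ac)
        then have "2 * c2 * s powr \<beta> \<le> c2 * s powr \<beta>" by (simp only: c2_def)
        then show False using c s by simp
      next
        fix x assume x: "x \<in> cball y (s / 2)" "c2 * (s / 2) powr \<beta> \<le> v x"
        have "C' * (c2 * (s / 2) powr \<beta>) powr p * s\<^sup>2 \<le> c1 * s powr \<alpha>"
          by (rule C'(2)[OF sub(2) sub(1) cont(2) cont(1) pp(2) _ nn'(1) s(1) _ _ sS x])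
             (use c s neg in \<open>auto simp: dbl intro: less_imp_le\<close>)
        then have "C' * c2 powr p * (1 / 2) powr (\<beta> * p) * (s powr (\<beta> * p) * s powr 2) \<le> c1 * s powr \<alpha>"
          using c s by (simp only: scale powr_numeral mult_ac)
        then have "2 * (A' * c2 powr p) * s powr \<alpha> \<le> c1 * s powr \<alpha>"
          unfolding powr_add[symmetric] ab(4) by (simp add: A'_def mult_ac)
        then have "2 * c1 * s powr \<alpha> \<le> c1 * s powr \<alpha>" by (simp only: c1eq[symmetric])
        then show False using c s by simp
      qed
    qed
    have lim: "(\<lambda>k. (a :: real) * (r / 2 ^ k) powr b) \<longlonglongrightarrow> 0" if "b > 0" for a b
    proof -
      have "(\<lambda>k. r * (1 / 2) ^ k) \<longlonglongrightarrow> r * 0"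
        by (intro tendsto_mult tendsto_const LIMSEQ_power_zero) auto
      then have "(\<lambda>k. r / 2 ^ k) \<longlonglongrightarrow> 0" by (simp add: power_divide)
      then have "(\<lambda>k. (r / 2 ^ k) powr b) \<longlonglongrightarrow> 0"
        using that r by (intro tendsto_zero_powrI[where b = b] tendsto_const) auto
      then show ?thesis using tendsto_mult_right_zero by blast
    qed
    have ex: "\<exists>k. a * (r / 2 ^ k) powr b < w" if "0 < b" "0 < w" for a b w :: real
      using eventually_happens'[OF sequentially_bot order_tendstoD(2)[OF lim[OF that(1)] that(2)]] .
    have yr: "y \<in> cball y (r / 2 ^ k)" for k using r by simp
    \<comment> \<open>At a fine enough scale a threshold drops below the positive value of
      \<open>u\<close> or \<open>v\<close> at \<open>y\<close>, so \<open>y\<close> itself is a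
      witness.\<close>
    obtain k where k: "P u v y (r / 2 ^ k)"
      using y ex[OF ab(1), of "u y" c1] ex[OF ab(2), of "v y" c2] yr less_imp_le
      unfolding P_def by blast
    have "P u v y (r / 2 ^ j)" if "j \<le> k" for j
      using that
    proof (induction rule: inc_induct)
      case base show ?case by (rule k)
    next
      case (step j)
      have "r \<le> r * 2 ^ j" using r by simp
      then have "r / 2 ^ j \<le> r" by (simp add: divide_le_eq)
      moreover have "P u v y (r / 2 ^ j / 2)" using step.IH by (simp add: mult.commute)
      ultimately show ?case using r by (intro up[of "r / 2 ^ j"]) simp_all
    qed
    from this[of 0] show ?thesis by simp
  qed
  with c show ?thesis unfolding P_def by (rule that)
qed

end

section \<open>From viscosity solutions of elliptic equations to subsolutions of the extremal
  inequality\<close>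

lemma largest_eig_scaled_mat: "largest_eig (s *\<^sub>R mat 1 :: real^'n^'n) = s"
proof -
  have "{e. \<exists>x. x \<noteq> 0 \<and> (s *\<^sub>R mat 1 :: real^'n^'n) *v x = e *\<^sub>R x} = {s}"
    by (auto simp: scaleR_matrix_vector_assoc[symmetric] matrix_vector_mul_lid intro!: exI[of _ "axis undefined 1"])
  then show ?thesis by (simp add: largest_eig_def)
qed

definition outer :: "real^'n \<Rightarrow> real^'n^'n" where
  "outer x = (\<chi> i j. x $ i * x $ j)"

lemma outer_mult: "outer x *v k = (x \<bullet> k) *\<^sub>R x"
  by (simp add: outer_def vec_eq_iff matrix_vector_mult_def inner_vec_def sum_distrib_left mult_ac)

text \<open>Pairing the eigenvalue equation with \<open>x\<close> leaves only 0 and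
  \<open>c * (norm x)\<^sup>2\<close>. In dimension one 0 need not be an eigenvalue, so the spectrum
  is only included in this pair.\<close>

lemma largest_eig_outer:
  assumes "0 \<le> c"
  shows "largest_eig (c *\<^sub>R outer x) = c * (norm x)\<^sup>2"
proof -
  define A where "A = {e. \<exists>w. w \<noteq> 0 \<and> (c *\<^sub>R outer x) *v w = e *\<^sub>R w}"
  have mul: "(c *\<^sub>R outer x) *v w = (c * (x \<bullet> w)) *\<^sub>R x" for w
    by (simp add: scaleR_matrix_vector_assoc[symmetric] outer_mult)
  have sub: "A \<subseteq> {0, c * (norm x)\<^sup>2}"
  proof
    fix e assume "e \<in> A"
    then obtain w where w: "w \<noteq> 0" "(c * (x \<bullet> w)) *\<^sub>R x = e *\<^sub>R w" by (auto simp: A_def mul)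
    have "x \<bullet> ((c * (x \<bullet> w)) *\<^sub>R x) = x \<bullet> (e *\<^sub>R w)" using w by simp
    then have "(x \<bullet> w) * (c * (norm x)\<^sup>2 - e) = 0"
      by (simp add: power2_norm_eq_inner algebra_simps)
    then consider "x \<bullet> w = 0" | "e = c * (norm x)\<^sup>2" by auto
    then show "e \<in> {0, c * (norm x)\<^sup>2}"
      using w by cases auto
  qed
  have mem: "c * (norm x)\<^sup>2 \<in> A"
  proof (cases "x = 0")
    case True
    then show ?thesis
      unfolding A_def mul by (auto intro!: exI[of _ "axis undefined 1"])
  next
    case False
    then show ?thesis
      unfolding A_def mul by (auto simp: power2_norm_eq_inner intro!: exI[of _ x])
  qed
  have "Max A = c * (norm x)\<^sup>2"
    using sub mem assms by (intro Max_eqI) (auto intro: finite_subset)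
  then show ?thesis by (simp add: largest_eig_def A_def)
qed

text \<open>Ellipticity controls only differences of \<open>F\<close>. Going from 0 up to
  \<open>s *\<^sub>R mat 1\<close> gains at most \<open>Lam * s\<close>, removing the rank-one part
  loses at least \<open>lam\<close> times its eigenvalue, and \<open>F 0 x0 = 0\<close> fixes the
  starting value.\<close>

lemma unif_elliptic_le:
  fixes F :: "real^'n^'n \<Rightarrow> real^'n \<Rightarrow> real"
  assumes F: "unif_elliptic F lam Lam" "F 0 x0 = 0" and x0: "x0 \<in> ball 0 1" and "0 \<le> s" "0 \<le> c"
  shows "F (s *\<^sub>R mat 1 - c *\<^sub>R outer z) x0 \<le> Lam * s - lam * (c * (norm z)\<^sup>2)"
proof -
  have sym: "sym_mat (s *\<^sub>R mat 1 - c *\<^sub>R outer z)" "sym_mat (0 :: real^'n^'n)"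
      "sym_mat (s *\<^sub>R mat 1 :: real^'n^'n)" "sym_mat (c *\<^sub>R outer z)"
    by (auto simp: sym_mat_def transpose_def vec_eq_iff mat_def outer_def)
  have nn: "nonneg_def (s *\<^sub>R mat 1 :: real^'n^'n)" "nonneg_def (c *\<^sub>R outer z)"
    using sym assms
    by (auto simp: nonneg_def_def scaleR_matrix_vector_assoc[symmetric] outer_mult inner_commute mult.assoc)
  have "lam * largest_eig (c *\<^sub>R outer z)
      \<le> F ((s *\<^sub>R mat 1 - c *\<^sub>R outer z) + c *\<^sub>R outer z) x0 - F (s *\<^sub>R mat 1 - c *\<^sub>R outer z) x0"
    using F(1) sym nn x0 unfolding unif_elliptic_def by blast
  moreover have "F (0 + s *\<^sub>R mat 1) x0 - F 0 x0 \<le> Lam * largest_eig (s *\<^sub>R mat 1 :: real^'n^'n)"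
    using F(1) sym nn x0 unfolding unif_elliptic_def by blast
  ultimately show ?thesis
    using F(2) \<open>0 \<le> c\<close> by (simp add: largest_eig_outer largest_eig_scaled_mat)
qed

lemma has_derivative_paraboloid_gaussian:
  fixes x y z :: "real^'n"
  shows "((\<lambda>x. a / 2 * (norm (x - y))\<^sup>2 - h * exp (- b * (norm (x - z))\<^sup>2)) has_derivative
    (\<lambda>k. (a *\<^sub>R (x - y) + (2 * b * h * exp (- b * (norm (x - z))\<^sup>2)) *\<^sub>R (x - z)) \<bullet> k)) (at x)"
  unfolding power2_norm_eq_inner
  by (auto intro!: derivative_eq_intros simp: fun_eq_iff algebra_simps inner_commute)

lemma has_derivative_gradient_paraboloid_gaussian:
  fixes x y z :: "real^'n"
  shows "((\<lambda>x. a *\<^sub>R (x - y) + (2 * b * h * exp (- b * (norm (x - z))\<^sup>2)) *\<^sub>R (x - z)) has_derivative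
    (\<lambda>k. ((a + 2 * b * h * exp (- b * (norm (x - z))\<^sup>2)) *\<^sub>R mat 1
      - (4 * b\<^sup>2 * h * exp (- b * (norm (x - z))\<^sup>2)) *\<^sub>R outer (x - z)) *v k)) (at x)"
  unfolding power2_norm_eq_inner matrix_vector_mult_diff_rdistrib scaleR_matrix_vector_assoc[symmetric]
    outer_mult matrix_vector_mul_lid
  by (auto intro!: derivative_eq_intros simp: fun_eq_iff algebra_simps inner_commute power2_eq_square)

lemma C2_with_paraboloid_gaussian:
  fixes y z :: "real^'n"
  shows "C2_with (\<lambda>x. a / 2 * (norm (x - y))\<^sup>2 - h * exp (- b * (norm (x - z))\<^sup>2))
    (\<lambda>x. a *\<^sub>R (x - y) + (2 * b * h * exp (- b * (norm (x - z))\<^sup>2)) *\<^sub>R (x - z))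
    (\<lambda>x. (a + 2 * b * h * exp (- b * (norm (x - z))\<^sup>2)) *\<^sub>R mat 1
      - (4 * b\<^sup>2 * h * exp (- b * (norm (x - z))\<^sup>2)) *\<^sub>R outer (x - z))"
  unfolding C2_with_def outer_def
  by (intro conjI allI has_derivative_paraboloid_gaussian
      has_derivative_gradient_paraboloid_gaussian[unfolded outer_def] continuous_intros)

text \<open>The paraboloid minus Gaussian is an admissible test function, and
  \<open>unif_elliptic_le\<close> bounds either operator at its Hessian.\<close>

lemma visc_sol_subsol:
  fixes F :: "real^'n^'n \<Rightarrow> real^'n \<Rightarrow> real"
  assumes "visc_sol F G p q u v" "unif_elliptic F lam Lam" "unif_elliptic G lam Lam"
    "\<forall>x\<in>ball 0 1. F 0 x = 0 \<and> G 0 x = 0"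
  shows "subsol lam Lam (\<lambda>x. pospow (v x) p) (ball 0 1) u"
    and "subsol lam Lam (\<lambda>x. pospow (u x) q) (ball 0 1) v"
proof -
  have le: "H ((a + 2 * b * h * exp (- b * (norm (x - z))\<^sup>2)) *\<^sub>R mat 1
      - (4 * b\<^sup>2 * h * exp (- b * (norm (x - z))\<^sup>2)) *\<^sub>R outer (x - z)) x
    \<le> Lam * (a + 2 * b * h * exp (- b * (norm (x - z))\<^sup>2))
      - lam * (4 * b\<^sup>2 * h * exp (- b * (norm (x - z))\<^sup>2) * (norm (x - z))\<^sup>2)"
    if "unif_elliptic H lam Lam" "H 0 x = 0" "x \<in> ball 0 1" "0 \<le> a" "0 \<le> b" "0 \<le> h"
    for H :: "real^'n^'n \<Rightarrow> real^'n \<Rightarrow> real" and x z :: "real^'n" and a b h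
    using that by (intro unif_elliptic_le) auto
  have visc: "F (Hs x0) x0 \<ge> pospow (v x0) p" if "C2_with \<phi> g Hs" "x0 \<in> ball 0 1"
    "loc_max_in (ball 0 1) (\<lambda>x. u x - \<phi> x) x0" for \<phi> g Hs x0
    using assms(1) that unfolding visc_sol_def by blast
  have visc': "G (Hs x0) x0 \<ge> pospow (u x0) q" if "C2_with \<phi> g Hs" "x0 \<in> ball 0 1"
    "loc_max_in (ball 0 1) (\<lambda>x. v x - \<phi> x) x0" for \<phi> g Hs x0
    using assms(1) that unfolding visc_sol_def by blast
  show "subsol lam Lam (\<lambda>x. pospow (v x) p) (ball 0 1) u"
    unfolding subsol_def
  proof (intro ballI allI impI)
    fix x0 y z :: "real^'n" and a h b :: real
    assume *: "x0 \<in> ball 0 1" "0 \<le> a" "0 \<le> h" "0 \<le> b"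
      "loc_max_in (ball 0 1) (\<lambda>x. u x - (a / 2 * (norm (x - y))\<^sup>2 - h * exp (- b * (norm (x - z))\<^sup>2))) x0"
    show "pospow (v x0) p \<le> Lam * (a + 2 * b * h * exp (- b * (norm (x0 - z))\<^sup>2))
      - lam * (4 * b\<^sup>2 * h * exp (- b * (norm (x0 - z))\<^sup>2) * (norm (x0 - z))\<^sup>2)"
      by (rule order_trans[OF visc[OF C2_with_paraboloid_gaussian *(1,5)] le[of F]]) (use assms * in auto)
  qed
  show "subsol lam Lam (\<lambda>x. pospow (u x) q) (ball 0 1) v"
    unfolding subsol_def
  proof (intro ballI allI impI)
    fix x0 y z :: "real^'n" and a h b :: real
    assume *: "x0 \<in> ball 0 1" "0 \<le> a" "0 \<le> h" "0 \<le> b"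
      "loc_max_in (ball 0 1) (\<lambda>x. v x - (a / 2 * (norm (x - y))\<^sup>2 - h * exp (- b * (norm (x - z))\<^sup>2))) x0"
    show "pospow (u x0) q \<le> Lam * (a + 2 * b * h * exp (- b * (norm (x0 - z))\<^sup>2))
      - lam * (4 * b\<^sup>2 * h * exp (- b * (norm (x0 - z))\<^sup>2) * (norm (x0 - z))\<^sup>2)"
      by (rule order_trans[OF visc'[OF C2_with_paraboloid_gaussian *(1,5)] le[of G]]) (use assms * in auto)
  qed
qed

theorem theorem4p1:
  fixes p q lam Lam :: real
  assumes "p \<ge> 0" "q \<ge> 0" "p * q < 1" "0 < lam" "lam \<le> Lam"
  shows "\<exists>c>0. \<forall>(F :: real^'n^'n \<Rightarrow> real^'n \<Rightarrow> real) G u v y r.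
     unif_elliptic F lam Lam \<longrightarrow> unif_elliptic G lam Lam \<longrightarrow>
     unif_cont_coeff F \<longrightarrow> unif_cont_coeff G \<longrightarrow>
     (\<forall>x\<in>ball 0 1. F 0 x = 0 \<and> G 0 x = 0) \<longrightarrow>
     visc_sol F G p q u v \<longrightarrow>
     (\<forall>x\<in>ball 0 1. u x \<ge> 0 \<and> v x \<ge> 0) \<longrightarrow>
     bounded (u ` ball 0 1) \<longrightarrow> bounded (v ` ball 0 1) \<longrightarrow>
     y \<in> closure {x \<in> ball 0 1. pair_abs p q u v x > 0} \<inter> ball 0 (1/2) \<longrightarrow>
     0 < r \<longrightarrow> r < 1/2 \<longrightarrow>
     Sup (pair_abs p q u v ` cball y r) \<ge> c * r powr (2 / (1 - p * q))"
proof -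
  define \<gamma> where "\<gamma> = 2 / (1 - p * q)"
  obtain c1 c2 where c: "0 < c1" "0 < c2" and main: "\<And>S (u :: real^'n \<Rightarrow> real) v y r.
     subsol lam Lam (\<lambda>x. pospow (v x) p) S u \<Longrightarrow> subsol lam Lam (\<lambda>x. pospow (u x) q) S v \<Longrightarrow>
     continuous_on S u \<Longrightarrow> continuous_on S v \<Longrightarrow> \<forall>x\<in>S. 0 \<le> u x \<and> 0 \<le> v x \<Longrightarrow>
     0 < u y \<or> 0 < v y \<Longrightarrow> 0 < r \<Longrightarrow> cball y r \<subseteq> S \<Longrightarrow>
     (\<exists>x\<in>cball y r. c1 * r powr (2 * (1 + p) / (1 - p * q)) \<le> u x)
     \<or> (\<exists>x\<in>cball y r. c2 * r powr (2 * (1 + q) / (1 - p * q)) \<le> v x)"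
    by (rule dichotomy_growth[OF assms(4,5,1-3), where 'n='n]) blast
  \<comment> \<open>The minimum lets one constant serve whichever of \<open>u\<close> and
    \<open>v\<close> grows; the roots bring both growth exponents to the common value
    \<open>\<gamma>\<close>.\<close>
  define k where "k = min (c1 powr (1 / (1 + p))) (c2 powr (1 / (1 + q)))"
  have k: "k > 0" using c by (simp add: k_def)
  have \<gamma>: "2 * (1 + s) / (1 - p * q) * (1 / (1 + s)) = \<gamma>" if "0 \<le> s" for s
    using that assms(3) by (simp add: \<gamma>_def divide_simps)
  have root: "k * (r / 2) powr \<gamma> \<le> w powr (1 / (1 + s))"
    if w: "C * (r / 2) powr (2 * (1 + s) / (1 - p * q)) \<le> w" and "0 \<le> s" "0 < C" "0 < r"
      "k \<le> C powr (1 / (1 + s))" for w s C r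
  proof -
    have "k * (r / 2) powr \<gamma> \<le> C powr (1 / (1 + s)) * (r / 2) powr \<gamma>"
      using that by (intro mult_right_mono) auto
    also have "\<dots> = (C * (r / 2) powr (2 * (1 + s) / (1 - p * q))) powr (1 / (1 + s))"
      using that by (simp only: powr_mult powr_powr \<gamma>)
    also have "\<dots> \<le> w powr (1 / (1 + s))"
      using that by (intro powr_mono2) auto
    finally show ?thesis .
  qed
  have "k * (1 / 2) powr \<gamma> * r powr \<gamma> \<le> Sup (pair_abs p q u v ` cball y r)"
    if ell: "unif_elliptic F lam Lam" "unif_elliptic G lam Lam"
    and F0: "\<forall>x\<in>ball 0 1. F 0 x = 0 \<and> G 0 x = 0"
    and vs: "visc_sol F G p q u v" and nn: "\<forall>x\<in>ball 0 1. u x \<ge> 0 \<and> v x \<ge> 0"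
    and y: "y \<in> closure {x \<in> ball 0 1. pair_abs p q u v x > 0} \<inter> ball 0 (1/2)"
    and r: "0 < r" "r < 1 / 2"
    for F G :: "real^'n^'n \<Rightarrow> real^'n \<Rightarrow> real" and u v y r
  proof -
    have cont: "continuous_on (ball 0 1) u" "continuous_on (ball 0 1) v"
      using vs by (auto simp: visc_sol_def)
    \<comment> \<open>A point of the closure may have \<open>u = v = 0\<close>. Growth is therefore
      applied at a nearby positivity point with radius \<open>r / 2\<close>, which costs the factor
      \<open>(1 / 2) powr \<gamma>\<close>.\<close>
    obtain y' where y': "y' \<in> ball 0 1" "pair_abs p q u v y' > 0" "dist y' y < r / 2"
      using y r by (auto simp: closure_approachable dest: spec[of _ "r / 2"])
    have ry: "cball y r \<subseteq> ball 0 1"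
    proof -
      have "cball y r \<subseteq> ball y (1 / 2)" using r by auto
      also have "\<dots> \<subseteq> ball 0 1" using y by (subst ball_subset_ball_iff) (auto simp: dist_norm)
      finally show ?thesis .
    qed
    have sub: "cball y' (r / 2) \<subseteq> cball y r"
      using y' r by (subst cball_subset_cball_iff) auto
    have pos: "0 < u y' \<or> 0 < v y'"
    proof (rule ccontr)
      assume "\<not> ?thesis"
      then have "u y' = 0" "v y' = 0" using nn y'(1) by force+
      then show False using y'(2) by (simp add: pair_abs_def)
    qed
    have "0 < r / 2" "cball y' (r / 2) \<subseteq> ball 0 1" using r sub ry by auto
    from main[OF visc_sol_subsol[OF vs ell F0] cont nn pos this]
    have "\<exists>x\<in>cball y' (r / 2). k * (r / 2) powr \<gamma> \<le> pair_abs p q u v x"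
    proof (elim disjE bexE)
      fix x assume x: "x \<in> cball y' (r / 2)" "c1 * (r / 2) powr (2 * (1 + p) / (1 - p * q)) \<le> u x"
      have "k * (r / 2) powr \<gamma> \<le> u x powr (1 / (1 + p))"
        by (rule root[OF x(2)]) (use assms c r in \<open>auto simp: k_def\<close>)
      also have "\<dots> \<le> pair_abs p q u v x" by (simp add: pair_abs_def)
      finally show ?thesis using x(1) by blast
    next
      fix x assume x: "x \<in> cball y' (r / 2)" "c2 * (r / 2) powr (2 * (1 + q) / (1 - p * q)) \<le> v x"
      have "k * (r / 2) powr \<gamma> \<le> v x powr (1 / (1 + q))"
        by (rule root[OF x(2)]) (use assms c r in \<open>auto simp: k_def\<close>)
      also have "\<dots> \<le> pair_abs p q u v x" by (simp add: pair_abs_def)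
      finally show ?thesis using x(1) by blast
    qed
    then obtain x where x: "x \<in> cball y r" "k * (r / 2) powr \<gamma> \<le> pair_abs p q u v x"
      using sub by blast
    \<comment> \<open>Continuity on the compact ball bounds the image from above, without which a
      real \<open>Sup\<close> would carry no information.\<close>
    have "continuous_on (cball y r) (pair_abs p q u v)"
      unfolding pair_abs_def using nn ry assms(1,2)
      by (intro continuous_on_add continuous_on_powr' continuous_on_const continuous_on_subset[OF cont(1) ry]
          continuous_on_subset[OF cont(2) ry]) (simp_all add: subset_iff)
    then have "bdd_above (pair_abs p q u v ` cball y r)"
      by (intro bounded_imp_bdd_above compact_imp_bounded compact_continuous_image) auto
    then have "pair_abs p q u v x \<le> Sup (pair_abs p q u v ` cball y r)"
      using x(1) by (intro cSup_upper) auto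
    moreover have "k * (r / 2) powr \<gamma> = k * (1 / 2) powr \<gamma> * r powr \<gamma>"
      using r by (simp add: powr_divide)
    ultimately show ?thesis using x(2) by linarith
  qed
  then show ?thesis
    using k unfolding \<gamma>_def by (intro exI[of _ "k * (1 / 2) powr (2 / (1 - p * q))"]) auto
qed
end
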